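(* Let $\mu\in\mathbb{R}$, $T>0$ and $r>1/2$. Assume that the exact solution $u$ of the quadratic Schr\"odinger equation $$i\partial_t u=-\partial_x^2u+\mu u^2,\qquad (t,x)\in\mathbb{R}\times\mathbb{T},$$ satisfies $u(t)\in H^r(\mathbb{T})$ for $0\le t\le T$. For a step size $\tau>0$ let $t_n=n\tau$, $u^0=u(0)$ and, for $n\ge0$, $$u^{n+1}=\left(1-2i\mu\tau\hat u_0^n\right)\mathrm{e}^{i\tau\partial_x^2}u^n+i\mu\tau(\hat u_0^n)^2+\frac{\mu}{2}\left(\mathrm{e}^{i\tau\partial_x^2}\partial_x^{-1}u^n\right)^2-\frac{\mu}{2}\mathrm{e}^{i\tau\partial_x^2}\left(\partial_x^{-1}u^n\right)^2.$$ Then there exists a constant $\tau_0>0$ such that for all step sizes $\tau\le\tau_0$ and all $t_n\le T$, $$\Vert u(t_n)-u^n\Vert_r\le c\,\tau,$$ where $c$ depends on $\sup_{0\le t\le T}\Vert u(t)\Vert_r$.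
   Context: $\mathbb{T}$ is the one-dimensional torus (period $2\pi$), functions are complex-valued with Fourier expansion $f(x)=\sum_{k\in\mathbb{Z}}\hat f_k\mathrm{e}^{ikx}$, and $\Vert\cdot\Vert_r$ is the standard Sobolev norm of $H^r=H^r(\mathbb{T})$, $\Vert f\Vert_r^2=\sum_k(1+|k|)^{2r}|\hat f_k|^2$. The operator $\mathrm{e}^{it\partial_x^2}$ multiplies $\hat f_k$ by $\mathrm{e}^{-itk^2}$, and $\partial_x^{-1}$ is the regularized inverse derivative $\partial_x^{-1}f(x)=\sum_{k\in\mathbb{Z}\setminus\{0\}}(ik)^{-1}\hat f_k\mathrm{e}^{ikx}$. $\hat u_0^n$ is the zeroth Fourier coefficient of $u^n$. The exact solution is understood in the mild sense, $$u(t)=\mathrm{e}^{it\partial_x^2}u(0)-i\mu\int_0^t\mathrm{e}^{i(t-s)\partial_x^2}\big(u(s)^2\big)\mathrm{d}s,$$ with finite supremum $\sup_{0\le t\le T}\Vert u(t)\Vert_r$. The constant $c$ may additionally depend on $r,\mu,T$, but neither $c$ nor $\tau_0$ depends on $\tau$ or $n$. *)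

theory Defs
  imports "HOL-Analysis.Analysis"
begin

text \<open>
  Functions on the torus are represented by \<open>2 * pi\<close>-periodic functions on the real line. Elements
  of \<open>H\<^sup>r\<close> are not quotiented by almost-everywhere equality: Fourier coefficients, membership in
  \<open>H\<^sup>r\<close>, the norm and the solution concept below do not depend on the choice of representative.
\<close>

definition fourier_coeff :: "(real \<Rightarrow> complex) \<Rightarrow> int \<Rightarrow> complex" where
  "fourier_coeff f k =
     (LINT x:{0..2 * pi}|lebesgue. f x * cis (- (of_int k * x))) / (2 * of_real pi)"

definition sobolev :: "real \<Rightarrow> (real \<Rightarrow> complex) set" where
  "sobolev r = {f.
     (\<forall>x. f (x + 2 * pi) = f x) \<and>
     f \<in> borel_measurable lebesgue \<and>
     set_integrable lebesgue {0..2 * pi} (\<lambda>x. (cmod (f x))\<^sup>2) \<and>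
     (\<lambda>k::int. (1 + \<bar>of_int k\<bar>) powr (2 * r) * (cmod (fourier_coeff f k))\<^sup>2) summable_on UNIV}"

text \<open>Only meaningful on \<open>sobolev r\<close>; the infinite sum defaults to 0 when it diverges.\<close>

definition sobolev_norm :: "real \<Rightarrow> (real \<Rightarrow> complex) \<Rightarrow> real" where
  "sobolev_norm r f =
     sqrt (\<Sum>\<^sub>\<infinity>k::int. (1 + \<bar>of_int k\<bar>) powr (2 * r) * (cmod (fourier_coeff f k))\<^sup>2)"

text \<open>
  The free group \<open>exp (i t d\<^sup>2/dx\<^sup>2)\<close> and the regularised inverse derivative, given by their Fourier
  series. For \<open>f\<close> in \<open>H\<^sup>r\<close> with \<open>r > 1/2\<close> the series converge absolutely at every point.
\<close>

definition schroedinger_flow :: "real \<Rightarrow> (real \<Rightarrow> complex) \<Rightarrow> real \<Rightarrow> complex" where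
  "schroedinger_flow t f x =
     (\<Sum>\<^sub>\<infinity>k::int. cis (- (t * (of_int k)\<^sup>2)) * fourier_coeff f k * cis (of_int k * x))"

definition inv_deriv :: "(real \<Rightarrow> complex) \<Rightarrow> real \<Rightarrow> complex" where
  "inv_deriv f x =
     (\<Sum>\<^sub>\<infinity>k::int\<in>UNIV - {0}. inverse (\<i> * of_int k) * fourier_coeff f k * cis (of_int k * x))"

text \<open>
  Duhamel's formula on \<open>[0, T]\<close>. The integral of the function-valued map \<open>s \<mapsto> \<dots>\<close> is taken at each
  fixed \<open>x\<close>; for \<open>r > 1/2\<close> point evaluation is continuous on \<open>H\<^sup>r\<close>, so every Bochner integral in
  \<open>H\<^sup>r\<close> is covered. The identity itself is one between elements of \<open>H\<^sup>r\<close>, hence almost everywhere.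
\<close>

definition mild_solution :: "real \<Rightarrow> real \<Rightarrow> (real \<Rightarrow> real \<Rightarrow> complex) \<Rightarrow> bool" where
  "mild_solution \<mu> T u \<longleftrightarrow> (\<forall>t\<in>{0..T}.
     (\<forall>x. set_integrable lebesgue {0..t}
            (\<lambda>s. schroedinger_flow (t - s) (\<lambda>y. (u s y)\<^sup>2) x)) \<and>
     (AE x in lebesgue.
        u t x = schroedinger_flow t (u 0) x
          - \<i> * of_real \<mu> *
            (LINT s:{0..t}|lebesgue. schroedinger_flow (t - s) (\<lambda>y. (u s y)\<^sup>2) x)))"

definition scheme_step :: "real \<Rightarrow> real \<Rightarrow> (real \<Rightarrow> complex) \<Rightarrow> real \<Rightarrow> complex" where
  "scheme_step \<mu> \<tau> v x =
     (1 - 2 * \<i> * of_real \<mu> * of_real \<tau> * fourier_coeff v 0) * schroedinger_flow \<tau> v x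
     + \<i> * of_real \<mu> * of_real \<tau> * (fourier_coeff v 0)\<^sup>2
     + of_real \<mu> / 2 * (schroedinger_flow \<tau> (inv_deriv v) x)\<^sup>2
     - of_real \<mu> / 2 * schroedinger_flow \<tau> (\<lambda>y. (inv_deriv v y)\<^sup>2) x"

primrec scheme :: "real \<Rightarrow> real \<Rightarrow> (real \<Rightarrow> complex) \<Rightarrow> nat \<Rightarrow> real \<Rightarrow> complex" where
  "scheme \<mu> \<tau> v 0 = v"
| "scheme \<mu> \<tau> v (Suc n) = scheme_step \<mu> \<tau> (scheme \<mu> \<tau> v n)"

end

theory Submission
  imports Defs
begin

text \<open>
  The proof takes place on the Fourier side. There the equation in Duhamel's form couples the
  coefficients through a convolution, and for \<open>r > 1/2\<close> the convolution is bounded in \<open>H\<^sup>r\<close>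
  (\<open>hs_bound_conv\<close>).

  Over one step from \<open>t\<close> to \<open>t + \<tau>\<close>, replace \<open>u(s)\<close> in Duhamel's integral by the free evolution of
  \<open>u(t)\<close>. Since \<open>(j + l)\<^sup>2 - j\<^sup>2 - l\<^sup>2 = 2 j l\<close>, the interaction of the frequencies \<open>j\<close> and \<open>l\<close>
  then oscillates with the phase \<open>2 j l (s - t)\<close> and can be integrated exactly. For \<open>j l \<noteq> 0\<close> the
  integration produces the factor \<open>1 / (j l)\<close>, that is, two inverse derivatives; for \<open>j l = 0\<close> it
  produces the terms that contain the zeroth coefficient. The result is precisely the numerical
  step (\<open>scheme_coeff_eq\<close>, \<open>scheme_step_eq_trig_series\<close>, \<open>integral_free_flow_conv\<close>). The only
  local error is thus the one of replacing \<open>u(s)\<close>, and \<open>u(s)\<close> differs from the free evolution of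
  \<open>u(t)\<close> by an integral of \<open>u\<^sup>2\<close> over \<open>[t, s]\<close>, which is \<open>O(s - t)\<close> in \<open>H\<^sup>r\<close> itself. Hence the
  local error is \<open>O(\<tau>\<^sup>2)\<close> without any additional regularity (\<open>scheme_local_error\<close>). Together with
  the Lipschitz stability of the step (\<open>scheme_coeff_stable\<close>), a discrete Gronwall argument gives
  convergence of first order (\<open>scheme_global_error\<close>).

  Passing to coefficients requires two facts about Fourier series. First, a function in \<open>H\<^sup>r\<close>
  agrees almost everywhere with its Fourier series, so that the coefficients of \<open>u\<^sup>2\<close> are a
  convolution; this rests on the uniqueness of Fourier coefficients (\<open>fourier_null_imp_AE_0\<close>),
  which is obtained from the Stone-Weierstrass theorem on the unit circle. Second, the
  coefficients of the integrand in Duhamel's formula have to be measurable in time, although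
  measurability is only given at every fixed point \<open>x\<close>; they are limits of averages over finitely
  many sample points (\<open>trig_series_sample_average\<close>).
\<close>

section \<open>Weighted sequence spaces\<close>

definition weight :: "real \<Rightarrow> int \<Rightarrow> real" where
  "weight r k = (1 + \<bar>of_int k\<bar>) powr r"

text \<open>
  The statement that the \<open>H\<^sup>r\<close> norm of a coefficient sequence is at most \<open>X\<close>, in terms of finite
  partial sums. Each such bound contains its own summability, and the triangle inequality and the
  passage to limits reduce to finite sums.
\<close>

definition hs_bound :: "real \<Rightarrow> (int \<Rightarrow> complex) \<Rightarrow> real \<Rightarrow> bool" where
  "hs_bound r a X \<longleftrightarrow> (\<forall>F. finite F \<longrightarrow> L2_set (\<lambda>k. weight r k * cmod (a k)) F \<le> X)"

lemma weight_pos: "weight r k > 0"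
  by (simp add: weight_def add_pos_nonneg)

lemma weight_ge_1: "r \<ge> 0 \<Longrightarrow> weight r k \<ge> 1"
  by (simp add: weight_def ge_one_powr_ge_zero)

lemma weight_sq: "(weight r k)\<^sup>2 = (1 + \<bar>of_int k\<bar>) powr (2 * r)"
  by (simp add: weight_def power2_eq_square flip: powr_add)

text \<open>
  Up to a constant, one of the two frequencies in a convolution carries the whole weight of their
  sum, since \<open>1 + \<bar>j + l\<bar> \<le> 2 max (1 + \<bar>j\<bar>) (1 + \<bar>l\<bar>)\<close>.
\<close>

lemma weight_sq_add_le:
  assumes "r \<ge> 0"
  shows "(weight r (j + l))\<^sup>2 \<le> 2 powr (2 * r) * ((weight r j)\<^sup>2 + (weight r l)\<^sup>2)"
proof -
  define M :: real where "M = max (1 + \<bar>of_int j\<bar>) (1 + \<bar>of_int l\<bar>)"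
  have "(1 + \<bar>of_int (j + l)\<bar> :: real) \<le> 2 * M"
    unfolding M_def by (auto simp: max_def)
  then have "(weight r (j + l))\<^sup>2 \<le> (2 * M) powr (2 * r)"
    unfolding weight_sq using assms by (intro powr_mono2) auto
  also have "\<dots> = 2 powr (2 * r) * M powr (2 * r)"
    by (rule powr_mult)
  also have "M powr (2 * r) \<le> (weight r j)\<^sup>2 + (weight r l)\<^sup>2"
    unfolding weight_sq M_def by (auto simp: max_def)
  finally show ?thesis by simp
qed

text \<open>
  This is where \<open>r > 1/2\<close> enters: the exponent \<open>2 r\<close> exceeds the dimension 1.
\<close>

lemma summable_inverse_weight_sq:
  assumes "r > 1 / 2"
  shows "(\<lambda>k. 1 / (weight r k)\<^sup>2) summable_on UNIV"
proof -
  let ?f = "\<lambda>k. 1 / (weight r k)\<^sup>2"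
  have "summable (\<lambda>n. real n powr (- 2 * r))"
    using assms by (subst summable_real_powr_iff) auto
  then have "summable (\<lambda>n. real (Suc n) powr (- 2 * r))"
    by (subst summable_Suc_iff)
  then have S: "(\<lambda>n::nat. 1 / (1 + real n) powr (2 * r)) summable_on UNIV"
    by (subst summable_on_UNIV_nonneg_real_iff) (auto simp: powr_minus_divide)
  have "?f summable_on range int"
    using S by (subst summable_on_reindex) (auto simp: o_def weight_sq)
  moreover have "?f summable_on range (\<lambda>n. - int n)"
    using S by (subst summable_on_reindex) (auto simp: o_def weight_sq inj_on_def)
  ultimately have "?f summable_on (range int \<union> range (\<lambda>n. - int n))"
    by (rule summable_on_union)
  moreover have "range int \<union> range (\<lambda>n. - int n) = UNIV"
  proof (intro equalityI subsetI)
    fix k :: int show "k \<in> range int \<union> range (\<lambda>n. - int n)"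
      by (cases k rule: int_cases2) auto
  qed simp
  ultimately show ?thesis by simp
qed

definition inv_weight_sum :: "real \<Rightarrow> real" where
  "inv_weight_sum r = (\<Sum>\<^sub>\<infinity>k. 1 / (weight r k)\<^sup>2)"

lemma sum_inverse_weight_sq_le:
  assumes "r > 1 / 2" "finite F"
  shows "(\<Sum>k\<in>F. 1 / (weight r k)\<^sup>2) \<le> inv_weight_sum r"
  unfolding inv_weight_sum_def
  by (rule finite_sum_le_infsum) (use assms summable_inverse_weight_sq in auto)

lemma inv_weight_sum_nonneg: "inv_weight_sum r \<ge> 0"
  unfolding inv_weight_sum_def by (rule infsum_nonneg) auto

lemma hs_bound_nonneg: "hs_bound r a X \<Longrightarrow> X \<ge> 0"
  unfolding hs_bound_def by (drule spec[of _ "{}"]) auto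

lemma hs_boundD: "hs_bound r a X \<Longrightarrow> finite F \<Longrightarrow> L2_set (\<lambda>k. weight r k * cmod (a k)) F \<le> X"
  by (auto simp: hs_bound_def)

lemma hs_bound_iff_sum:
  assumes "X \<ge> 0"
  shows "hs_bound r a X \<longleftrightarrow>
    (\<forall>F. finite F \<longrightarrow> (\<Sum>k\<in>F. (weight r k)\<^sup>2 * (cmod (a k))\<^sup>2) \<le> X\<^sup>2)"
proof -
  have "L2_set (\<lambda>k. weight r k * cmod (a k)) F \<le> X \<longleftrightarrow>
      (\<Sum>k\<in>F. (weight r k)\<^sup>2 * (cmod (a k))\<^sup>2) \<le> X\<^sup>2" for F
    unfolding L2_set_def power_mult_distrib
    using assms real_sqrt_le_iff[of _ "X\<^sup>2"] by simp
  then show ?thesis by (simp add: hs_bound_def)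
qed

lemma hs_bound_mono: "hs_bound r a X \<Longrightarrow> X \<le> Y \<Longrightarrow> hs_bound r a Y"
  unfolding hs_bound_def by (meson order_trans)

lemma hs_bound_add:
  assumes "hs_bound r a X" "hs_bound r b Y"
  shows "hs_bound r (\<lambda>k. a k + b k) (X + Y)"
  unfolding hs_bound_def
proof (intro allI impI)
  fix F :: "int set" assume F: "finite F"
  have "L2_set (\<lambda>k. weight r k * cmod (a k + b k)) F
      \<le> L2_set (\<lambda>k. weight r k * cmod (a k) + weight r k * cmod (b k)) F"
    by (rule L2_set_mono)
      (auto simp: less_imp_le[OF weight_pos] norm_triangle_ineq mult_left_mono simp flip: distrib_left)
  also have "\<dots> \<le> L2_set (\<lambda>k. weight r k * cmod (a k)) F + L2_set (\<lambda>k. weight r k * cmod (b k)) F"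
    by (rule L2_set_triangle_ineq)
  also have "\<dots> \<le> X + Y"
    using assms F by (intro add_mono hs_boundD)
  finally show "L2_set (\<lambda>k. weight r k * cmod (a k + b k)) F \<le> X + Y" .
qed

text \<open>
  Covers scalar factors and Fourier multipliers alike, because only the moduli are compared.
\<close>

lemma hs_bound_mult:
  assumes "hs_bound r a X" "c \<ge> 0" "\<And>k. cmod (b k) \<le> c * cmod (a k)"
  shows "hs_bound r b (c * X)"
  unfolding hs_bound_def
proof (intro allI impI)
  fix F :: "int set" assume F: "finite F"
  have "L2_set (\<lambda>k. weight r k * cmod (b k)) F \<le> L2_set (\<lambda>k. c * (weight r k * cmod (a k))) F"
    using assms(3) weight_pos
    by (intro L2_set_mono)
      (auto simp: less_imp_le[OF weight_pos] mult.left_commute[of c] intro!: mult_left_mono)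
  also have "\<dots> = c * L2_set (\<lambda>k. weight r k * cmod (a k)) F"
    using assms(2) by (rule L2_set_right_distrib[symmetric])
  also have "\<dots> \<le> c * X"
    using assms F by (intro mult_left_mono hs_boundD)
  finally show "L2_set (\<lambda>k. weight r k * cmod (b k)) F \<le> c * X" .
qed

lemma hs_bound_diff:
  assumes "hs_bound r a X" "hs_bound r b Y"
  shows "hs_bound r (\<lambda>k. a k - b k) (X + Y)"
proof -
  have "hs_bound r (\<lambda>k. - b k) Y" using hs_bound_mult[OF assms(2), of 1 "\<lambda>k. - b k"] by simp
  from hs_bound_add[OF assms(1) this] show ?thesis by simp
qed

text \<open>
  Sobolev embedding on the Fourier side, by Cauchy-Schwarz against the inverse weights.
\<close>

lemma hs_bound_l1:
  assumes "r > 1 / 2" "hs_bound r a X" "finite F"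
  shows "(\<Sum>k\<in>F. cmod (a k)) \<le> sqrt (inv_weight_sum r) * X"
proof -
  have "(\<Sum>k\<in>F. cmod (a k)) = (\<Sum>k\<in>F. \<bar>1 / weight r k\<bar> * \<bar>weight r k * cmod (a k)\<bar>)"
    using weight_pos[of r] by (intro sum.cong) (auto simp: abs_mult less_imp_neq[THEN not_sym])
  also have "\<dots> \<le> L2_set (\<lambda>k. 1 / weight r k) F * L2_set (\<lambda>k. weight r k * cmod (a k)) F"
    by (rule L2_set_mult_ineq)
  also have "\<dots> \<le> sqrt (inv_weight_sum r) * X"
    using sum_inverse_weight_sq_le[OF assms(1,3)] assms
    by (intro mult_mono hs_boundD)
      (auto simp: L2_set_def power_divide inv_weight_sum_nonneg sum_nonneg)
  finally show ?thesis .
qed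

lemma hs_bound_abs_summable:
  assumes "r > 1 / 2" "hs_bound r a X"
  shows "(\<lambda>k. cmod (a k)) summable_on UNIV"
  by (rule nonneg_bdd_above_summable_on)
    (use hs_bound_l1[OF assms] in \<open>auto simp: bdd_above_def\<close>)

section \<open>Convolution and the algebra property\<close>

text \<open>
  A bilinear Fourier multiplier: \<open>m j l\<close> weights the interaction of the frequencies \<open>j\<close> and \<open>l\<close>.
  The symbol \<open>1\<close> gives the product of functions, and exact time integration of the oscillating
  phases gives another bounded symbol, so that both are treated at once.
\<close>

definition twisted_conv ::
    "(int \<Rightarrow> int \<Rightarrow> complex) \<Rightarrow> (int \<Rightarrow> complex) \<Rightarrow> (int \<Rightarrow> complex) \<Rightarrow> int \<Rightarrow> complex" where
  "twisted_conv m a b k = (\<Sum>\<^sub>\<infinity>j. m j (k - j) * a j * b (k - j))"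

abbreviation "conv \<equiv> twisted_conv (\<lambda>_ _. 1)"

text \<open>
  Cauchy-Schwarz in \<open>\<ell>\<^sup>2\<close>; the weights are at least 1 and can be dropped.
\<close>

lemma sum_conv_terms_le:
  assumes r: "r \<ge> 0" and a: "hs_bound r a X" and b: "hs_bound r b Y" and F: "finite F"
    and m: "\<And>j l. cmod (m j l) \<le> c"
  shows "(\<Sum>j\<in>F. cmod (m j (k - j) * a j * b (k - j))) \<le> c * (X * Y)"
proof -
  have c: "c \<ge> 0" using m[of 0 0] norm_ge_zero order_trans by blast
  have le: "L2_set (\<lambda>k. cmod (f k)) F \<le> Z" if "hs_bound r f Z" "finite F" for f Z F
  proof -
    have "L2_set (\<lambda>k. cmod (f k)) F \<le> L2_set (\<lambda>k. weight r k * cmod (f k)) F"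
      using weight_ge_1[OF r] by (intro L2_set_mono) (auto simp: mult_le_cancel_right1)
    with hs_boundD[OF that] show ?thesis by simp
  qed
  have inj: "inj_on (\<lambda>j. k - j) F" by (auto simp: inj_on_def)
  have "L2_set (\<lambda>j. cmod (b (k - j))) F = L2_set (\<lambda>j. cmod (b j)) ((\<lambda>j. k - j) ` F)"
    unfolding L2_set_def by (simp add: sum.reindex[OF inj] o_def)
  also have "\<dots> \<le> Y" using le[OF b] F by simp
  finally have bY: "L2_set (\<lambda>j. cmod (b (k - j))) F \<le> Y" .
  have "(\<Sum>j\<in>F. cmod (m j (k - j) * a j * b (k - j))) \<le> (\<Sum>j\<in>F. c * (\<bar>cmod (a j)\<bar> * \<bar>cmod (b (k - j))\<bar>))"
    unfolding norm_mult mult.assoc using m by (intro sum_mono) (auto intro!: mult_right_mono)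
  also have "\<dots> = c * (\<Sum>j\<in>F. \<bar>cmod (a j)\<bar> * \<bar>cmod (b (k - j))\<bar>)"
    by (rule sum_distrib_left[symmetric])
  also have "\<dots> \<le> c * (L2_set (\<lambda>j. cmod (a j)) F * L2_set (\<lambda>j. cmod (b (k - j))) F)"
    using c by (intro mult_left_mono L2_set_mult_ineq)
  also have "\<dots> \<le> c * (X * Y)"
    using le[OF a F] bY c hs_bound_nonneg[OF a] by (intro mult_left_mono mult_mono) auto
  finally show ?thesis .
qed

lemma conv_terms_summable:
  assumes "r \<ge> 0" "hs_bound r a X" "hs_bound r b Y" "\<And>j l. cmod (m j l) \<le> c"
  shows "(\<lambda>j. cmod (m j (k - j) * a j * b (k - j))) summable_on UNIV"
proof (rule nonneg_bdd_above_summable_on)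
  show "bdd_above (sum (\<lambda>j. cmod (m j (k - j) * a j * b (k - j))) ` {F. F \<subseteq> UNIV \<and> finite F})"
    using sum_conv_terms_le[OF assms(1-3) _ assms(4)] by (intro bdd_aboveI2) auto
qed simp

definition algebra_const :: "real \<Rightarrow> real" where
  "algebra_const r = sqrt (2 * 2 powr (2 * r) * inv_weight_sum r)"

lemma algebra_const_nonneg: "algebra_const r \<ge> 0"
  by (simp add: algebra_const_def inv_weight_sum_nonneg)

text \<open>
  The algebra property of \<open>H\<^sup>r\<close>. Write \<open>\<langle>k\<rangle> = 1 + \<bar>k\<bar>\<close>. At each output frequency, Cauchy-Schwarz
  separates the kernel \<open>1 / (\<langle>j\<rangle>\<^sup>2\<^sup>r \<langle>k - j\<rangle>\<^sup>2\<^sup>r)\<close>, whose sum over \<open>j\<close> times \<open>\<langle>k\<rangle>\<^sup>2\<^sup>r\<close> is bounded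
  uniformly in \<open>k\<close>, from the plain convolution of the two sequences of weighted squares, whose sum
  over \<open>k\<close> is the product of the two sums of squares. Both estimates are made with the inner sum
  restricted to a finite set \<open>J\<close>, and the bound survives the limit over \<open>J\<close>.
\<close>

lemma hs_bound_conv:
  assumes r: "r > 1 / 2" and a: "hs_bound r a X" and b: "hs_bound r b Y"
    and m: "\<And>j l. cmod (m j l) \<le> c"
  shows "hs_bound r (twisted_conv m a b) (c * algebra_const r * X * Y)"
proof -
  have c: "c \<ge> 0" using m[of 0 0] norm_ge_zero order_trans by blast
  have X: "X \<ge> 0" and Y: "Y \<ge> 0" using a b hs_bound_nonneg by auto
  define p where "p j = (weight r j)\<^sup>2 * (cmod (a j))\<^sup>2" for j
  define q where "q j = (weight r j)\<^sup>2 * (cmod (b j))\<^sup>2" for j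
  define D where "D = c\<^sup>2 * (2 * 2 powr (2 * r) * inv_weight_sum r)"
  have D: "D \<ge> 0" by (simp add: D_def inv_weight_sum_nonneg)
  have p: "(\<Sum>j\<in>J. p j) \<le> X\<^sup>2" if "finite J" for J
    using a X that by (simp add: p_def hs_bound_iff_sum)
  have q: "(\<Sum>j\<in>J. q j) \<le> Y\<^sup>2" if "finite J" for J
    using b Y that by (simp add: q_def hs_bound_iff_sum)
  have p0: "p j \<ge> 0" and q0: "q j \<ge> 0" for j by (auto simp: p_def q_def)
  define s where "s J k = (\<Sum>j\<in>J. m j (k - j) * a j * b (k - j))" for J k
  \<comment> \<open>\<open>\<langle>k\<rangle>\<^sup>2\<^sup>r\<close> is absorbed by one of the two factors of the kernel, and the other one is summable.\<close>
  have kernel: "(weight r k)\<^sup>2 * (\<Sum>j\<in>J. 1 / ((weight r j)\<^sup>2 * (weight r (k - j))\<^sup>2))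
      \<le> 2 * 2 powr (2 * r) * inv_weight_sum r" if J: "finite J" for J k
  proof -
    have inj: "inj_on (\<lambda>j. k - j) J" by (auto simp: inj_on_def)
    have "(\<Sum>j\<in>J. 1 / (weight r (k - j))\<^sup>2) = (\<Sum>j\<in>(\<lambda>j. k - j) ` J. 1 / (weight r j)\<^sup>2)"
      by (simp add: sum.reindex[OF inj] o_def)
    also have "\<dots> \<le> inv_weight_sum r" using J r by (intro sum_inverse_weight_sq_le) auto
    finally have 1: "(\<Sum>j\<in>J. 1 / (weight r (k - j))\<^sup>2) \<le> inv_weight_sum r" .
    have "(weight r k)\<^sup>2 * (\<Sum>j\<in>J. 1 / ((weight r j)\<^sup>2 * (weight r (k - j))\<^sup>2))
       = (\<Sum>j\<in>J. (weight r k)\<^sup>2 / ((weight r j)\<^sup>2 * (weight r (k - j))\<^sup>2))"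
      by (simp add: sum_distrib_left)
    also have "\<dots> \<le> (\<Sum>j\<in>J. 2 powr (2 * r) * (1 / (weight r j)\<^sup>2 + 1 / (weight r (k - j))\<^sup>2))"
    proof (rule sum_mono)
      fix j
      have w: "(weight r j)\<^sup>2 > 0" "(weight r (k - j))\<^sup>2 > 0"
        using weight_pos[of r] by (simp_all add: less_imp_neq[THEN not_sym])
      have "(weight r k)\<^sup>2 \<le> 2 powr (2 * r) * ((weight r j)\<^sup>2 + (weight r (k - j))\<^sup>2)"
        using weight_sq_add_le[of r j "k - j"] r by simp
      then have "(weight r k)\<^sup>2 / ((weight r j)\<^sup>2 * (weight r (k - j))\<^sup>2)
          \<le> 2 powr (2 * r) * ((weight r j)\<^sup>2 + (weight r (k - j))\<^sup>2) / ((weight r j)\<^sup>2 * (weight r (k - j))\<^sup>2)"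
        using w by (intro divide_right_mono) auto
      also have "\<dots> = 2 powr (2 * r) * (1 / (weight r j)\<^sup>2 + 1 / (weight r (k - j))\<^sup>2)"
        using w by (simp add: field_simps)
      finally show "(weight r k)\<^sup>2 / ((weight r j)\<^sup>2 * (weight r (k - j))\<^sup>2)
          \<le> 2 powr (2 * r) * (1 / (weight r j)\<^sup>2 + 1 / (weight r (k - j))\<^sup>2)" .
    qed
    also have "\<dots> = 2 powr (2 * r) * ((\<Sum>j\<in>J. 1 / (weight r j)\<^sup>2) + (\<Sum>j\<in>J. 1 / (weight r (k - j))\<^sup>2))"
      by (simp only: sum.distrib flip: sum_distrib_left)
    also have "\<dots> \<le> 2 powr (2 * r) * (inv_weight_sum r + inv_weight_sum r)"
      using 1 J r by (intro mult_left_mono add_mono sum_inverse_weight_sq_le) auto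
    finally show ?thesis by simp
  qed
  have pointwise: "(weight r k)\<^sup>2 * (cmod (s J k))\<^sup>2 \<le> D * (\<Sum>j\<in>J. p j * q (k - j))"
    if J: "finite J" for J k
  proof -
    let ?u = "\<lambda>j. 1 / (weight r j * weight r (k - j))"
    let ?v = "\<lambda>j. (weight r j * cmod (a j)) * (weight r (k - j) * cmod (b (k - j)))"
    have "cmod (s J k) \<le> (\<Sum>j\<in>J. c * (\<bar>?u j\<bar> * \<bar>?v j\<bar>))"
      unfolding s_def
    proof (rule order_trans[OF norm_sum], rule sum_mono)
      fix j
      have w: "weight r j > 0" "weight r (k - j) > 0" using weight_pos by auto
      have "cmod (m j (k - j) * a j * b (k - j)) \<le> c * (cmod (a j) * cmod (b (k - j)))"
        unfolding norm_mult mult.assoc using m by (intro mult_right_mono) auto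
      also have "\<dots> = c * (\<bar>?u j\<bar> * \<bar>?v j\<bar>)"
        using w by (simp add: abs_mult)
      finally show "cmod (m j (k - j) * a j * b (k - j)) \<le> c * (\<bar>?u j\<bar> * \<bar>?v j\<bar>)" .
    qed
    also have "\<dots> = c * (\<Sum>j\<in>J. \<bar>?u j\<bar> * \<bar>?v j\<bar>)" by (simp add: sum_distrib_left)
    also have "\<dots> \<le> c * (L2_set ?u J * L2_set ?v J)"
      using c by (intro mult_left_mono L2_set_mult_ineq)
    finally have "(cmod (s J k))\<^sup>2 \<le> (c * (L2_set ?u J * L2_set ?v J))\<^sup>2"
      by (intro power_mono) auto
    also have "\<dots> = c\<^sup>2 * ((\<Sum>j\<in>J. 1 / ((weight r j)\<^sup>2 * (weight r (k - j))\<^sup>2)) * (\<Sum>j\<in>J. p j * q (k - j)))"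
      by (simp add: power_mult_distrib L2_set_def sum_nonneg p_def q_def power_divide algebra_simps)
    finally have "(weight r k)\<^sup>2 * (cmod (s J k))\<^sup>2 \<le> (weight r k)\<^sup>2 *
        (c\<^sup>2 * ((\<Sum>j\<in>J. 1 / ((weight r j)\<^sup>2 * (weight r (k - j))\<^sup>2)) * (\<Sum>j\<in>J. p j * q (k - j))))"
      by (rule mult_left_mono) simp
    also have "\<dots> = c\<^sup>2 * ((weight r k)\<^sup>2 *
        (\<Sum>j\<in>J. 1 / ((weight r j)\<^sup>2 * (weight r (k - j))\<^sup>2))) * (\<Sum>j\<in>J. p j * q (k - j))"
      by (simp only: ac_simps)
    also have "\<dots> \<le> D * (\<Sum>j\<in>J. p j * q (k - j))"
      unfolding D_def using kernel[OF J, of k] p0 q0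
      by (intro mult_right_mono mult_left_mono sum_nonneg) auto
    finally show ?thesis .
  qed
  have partial: "(\<Sum>k\<in>F. (weight r k)\<^sup>2 * (cmod (s J k))\<^sup>2) \<le> D * (X\<^sup>2 * Y\<^sup>2)"
    if J: "finite J" and F: "finite F" for J F
  proof -
    have "(\<Sum>k\<in>F. (weight r k)\<^sup>2 * (cmod (s J k))\<^sup>2) \<le> (\<Sum>k\<in>F. D * (\<Sum>j\<in>J. p j * q (k - j)))"
      by (rule sum_mono) (rule pointwise[OF J])
    also have "\<dots> = D * (\<Sum>j\<in>J. p j * (\<Sum>k\<in>F. q (k - j)))"
      by (simp add: sum_distrib_left sum.swap[of _ F])
    also have "\<dots> \<le> D * (\<Sum>j\<in>J. p j * Y\<^sup>2)"
    proof (intro mult_left_mono sum_mono)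
      fix j
      have inj: "inj_on (\<lambda>k. k - j) F" by (auto simp: inj_on_def)
      have "(\<Sum>k\<in>F. q (k - j)) = (\<Sum>k\<in>(\<lambda>k. k - j) ` F. q k)"
        by (simp add: sum.reindex[OF inj] o_def)
      also have "\<dots> \<le> Y\<^sup>2" using F by (intro q) auto
      finally show "(\<Sum>k\<in>F. q (k - j)) \<le> Y\<^sup>2" .
    qed (use D p0 in auto)
    also have "\<dots> \<le> D * (X\<^sup>2 * Y\<^sup>2)"
      using p[OF J] D by (intro mult_left_mono) (auto simp: mult_right_mono simp flip: sum_distrib_right)
    finally show ?thesis .
  qed
  have "(\<Sum>k\<in>F. (weight r k)\<^sup>2 * (cmod (twisted_conv m a b k))\<^sup>2) \<le> D * (X\<^sup>2 * Y\<^sup>2)"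
    if F: "finite F" for F
  proof (rule tendsto_upperbound)
    have "((\<lambda>J. s J k) \<longlongrightarrow> twisted_conv m a b k) (finite_subsets_at_top UNIV)" for k
      unfolding s_def twisted_conv_def
      by (rule infsum_tendsto, rule abs_summable_summable, rule conv_terms_summable[OF _ a b m])
        (use r in auto)
    then show "((\<lambda>J. \<Sum>k\<in>F. (weight r k)\<^sup>2 * (cmod (s J k))\<^sup>2) \<longlongrightarrow>
        (\<Sum>k\<in>F. (weight r k)\<^sup>2 * (cmod (twisted_conv m a b k))\<^sup>2)) (finite_subsets_at_top UNIV)"
      by (intro tendsto_intros)
    show "\<forall>\<^sub>F J in finite_subsets_at_top UNIV. (\<Sum>k\<in>F. (weight r k)\<^sup>2 * (cmod (s J k))\<^sup>2) \<le> D * (X\<^sup>2 * Y\<^sup>2)"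
      using partial[OF _ F] by (simp add: eventually_finite_subsets_at_top_weakI)
  qed auto
  moreover have "D * (X\<^sup>2 * Y\<^sup>2) = (c * algebra_const r * X * Y)\<^sup>2"
    by (simp add: D_def algebra_const_def power_mult_distrib inv_weight_sum_nonneg)
  ultimately show ?thesis
    using c X Y algebra_const_nonneg[of r] by (subst hs_bound_iff_sum) auto
qed

lemma twisted_conv_square_diff:
  assumes "r \<ge> 0" "hs_bound r a X" "hs_bound r b Y" "\<And>j l. cmod (m j l) \<le> c"
  shows "twisted_conv m a a k - twisted_conv m b b k =
    twisted_conv m (\<lambda>k. a k - b k) a k + twisted_conv m b (\<lambda>k. a k - b k) k"
proof -
  have S: "(\<lambda>j. m j (k - j) * f j * g (k - j)) summable_on UNIV"
    if "hs_bound r f U" "hs_bound r g V" for f g U V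
    by (rule abs_summable_summable, rule conv_terms_summable[OF assms(1) that assms(4)])
  note d = hs_bound_diff[OF assms(2,3)]
  have "twisted_conv m (\<lambda>k. a k - b k) a k + twisted_conv m b (\<lambda>k. a k - b k) k =
    (\<Sum>\<^sub>\<infinity>j. m j (k - j) * (a j - b j) * a (k - j) + m j (k - j) * b j * (a (k - j) - b (k - j)))"
    unfolding twisted_conv_def
    by (rule infsum_add[OF S[OF d assms(2)] S[OF assms(3) d], symmetric])
  also have "\<dots> = (\<Sum>\<^sub>\<infinity>j. m j (k - j) * a j * a (k - j) + - (m j (k - j) * b j * b (k - j)))"
    by (intro infsum_cong) (simp add: algebra_simps)
  also have "\<dots> = twisted_conv m a a k + (\<Sum>\<^sub>\<infinity>j. - (m j (k - j) * b j * b (k - j)))"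
    unfolding twisted_conv_def
    by (rule infsum_add[OF S[OF assms(2) assms(2)] summable_on_uminus[THEN iffD2, OF S[OF assms(3) assms(3)]]])
  finally show ?thesis by (simp add: infsum_uminus twisted_conv_def)
qed

text \<open>
  Local Lipschitz continuity of the quadratic term, from \<open>B(a, a) - B(b, b) = B(a - b, a) + B(b, a
  - b)\<close>.
\<close>

lemma hs_bound_conv_square_diff:
  assumes r: "r > 1 / 2" and a: "hs_bound r a X" and b: "hs_bound r b Y"
    and d: "hs_bound r (\<lambda>k. a k - b k) D" and m: "\<And>j l. cmod (m j l) \<le> c"
  shows "hs_bound r (\<lambda>k. twisted_conv m a a k - twisted_conv m b b k)
    (c * algebra_const r * (X + Y) * D)"
proof -
  have "hs_bound r (\<lambda>k. twisted_conv m (\<lambda>k. a k - b k) a k + twisted_conv m b (\<lambda>k. a k - b k) k)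
     (c * algebra_const r * D * X + c * algebra_const r * Y * D)"
    by (intro hs_bound_add hs_bound_conv assms)
  then show ?thesis
    using r by (subst twisted_conv_square_diff[OF _ a b m]) (auto simp: algebra_simps)
qed

section \<open>Integrals of sequences depending on a parameter\<close>

text \<open>
  Replaces the net of finite subsets by a sequence, so that theorems on sequences of measurable
  functions apply.
\<close>

lemma has_sum_imp_symmetric_sums:
  fixes f :: "int \<Rightarrow> 'a :: {comm_monoid_add, topological_space}"
  assumes "(f has_sum S) UNIV"
  shows "(\<lambda>n. \<Sum>k\<in>{- int n..int n}. f k) \<longlonglongrightarrow> S"
proof -
  have "filterlim (\<lambda>n. {- int n..int n}) (finite_subsets_at_top UNIV) sequentially"
    unfolding filterlim_finite_subsets_at_top
  proof (intro allI impI)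
    fix X :: "int set" assume X: "finite X \<and> X \<subseteq> UNIV"
    \<comment> \<open>Any upper bound for \<open>\<bar>k\<bar>\<close> on \<open>X\<close> would do; the sum also covers \<open>X = {}\<close>.\<close>
    define m where "m = nat (\<Sum>k\<in>X. \<bar>k\<bar>)"
    have "\<bar>k\<bar> \<le> int m" if "k \<in> X" for k
      using X that member_le_sum[of k X abs] by (simp add: m_def)
    then have "X \<subseteq> {- int n..int n}" if "n \<ge> m" for n
      using that by (force simp: abs_le_iff)
    then show "\<forall>\<^sub>F n in sequentially.
        finite {- int n..int n} \<and> X \<subseteq> {- int n..int n} \<and> {- int n..int n} \<subseteq> UNIV"
      unfolding eventually_sequentially by auto
  qed
  with assms show ?thesis
    unfolding has_sum_def by (rule filterlim_compose)
qed

lemma set_integrable_bounded: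
  fixes f :: "real \<Rightarrow> complex"
  assumes "I \<in> lmeasurable" "set_borel_measurable lebesgue I f" "\<And>s. s \<in> I \<Longrightarrow> cmod (f s) \<le> K"
  shows "set_integrable lebesgue I f"
  unfolding set_integrable_def
  using assms
  by (intro integrableI_bounded_set[where A = I and B = K])
    (auto simp: set_borel_measurable_def fmeasurable_def indicator_def)

lemma norm_set_integral_le:
  fixes f :: "real \<Rightarrow> complex"
  assumes I: "I \<in> lmeasurable" and K: "\<And>s. s \<in> I \<Longrightarrow> cmod (f s) \<le> K"
  shows "cmod (LINT s:I|lebesgue. f s) \<le> measure lebesgue I * K"
proof -
  have "cmod (LINT s:I|lebesgue. f s) \<le> (LINT s|lebesgue. norm (indicator I s *\<^sub>R f s))"
    unfolding set_lebesgue_integral_def by (rule integral_norm_bound)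
  also have "\<dots> \<le> (LINT s|lebesgue. indicator I s * K)"
  proof (rule integral_mono')
    show "integrable lebesgue (\<lambda>s. indicator I s * K)"
      using I by (intro integrable_mult_left integrable_real_indicator)
        (auto simp: fmeasurable_def)
  next
    fix s show "norm (indicator I s *\<^sub>R f s) \<le> indicator I s * K"
      using K by (auto simp: indicator_def)
    then show "0 \<le> indicator I s * K" by (rule order_trans[OF norm_ge_zero])
  qed
  also have "\<dots> = measure lebesgue I * K"
    by simp
  finally show ?thesis .
qed

lemma set_borel_measurable_sum:
  fixes f :: "'i \<Rightarrow> real \<Rightarrow> complex"
  assumes "\<And>k. k \<in> F \<Longrightarrow> set_borel_measurable lebesgue I (f k)"
  shows "set_borel_measurable lebesgue I (\<lambda>s. \<Sum>k\<in>F. f k s)"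
  using assms unfolding set_borel_measurable_def scaleR_sum_right by (rule borel_measurable_sum)

lemma set_borel_measurable_cmult:
  fixes f :: "real \<Rightarrow> complex"
  assumes "set_borel_measurable lebesgue I f"
  shows "set_borel_measurable lebesgue I (\<lambda>s. c * f s)"
proof -
  have "(\<lambda>s. c * (indicator I s *\<^sub>R f s)) \<in> borel_measurable lebesgue"
    using assms unfolding set_borel_measurable_def by (intro borel_measurable_times) auto
  then show ?thesis by (simp add: set_borel_measurable_def)
qed

lemma set_borel_measurable_mult_continuous:
  fixes f g :: "real \<Rightarrow> complex"
  assumes "set_borel_measurable lebesgue I f" "continuous_on UNIV g"
  shows "set_borel_measurable lebesgue I (\<lambda>s. g s * f s)"
proof -
  have "g \<in> borel_measurable lebesgue"
    using assms(2) by (simp add: borel_measurable_continuous_onI measurable_completion)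
  then have "(\<lambda>s. g s * (indicator I s *\<^sub>R f s)) \<in> borel_measurable lebesgue"
    using assms unfolding set_borel_measurable_def by (intro borel_measurable_times) auto
  then show ?thesis by (simp add: set_borel_measurable_def)
qed

lemma set_borel_measurable_infsum:
  fixes f :: "int \<Rightarrow> real \<Rightarrow> complex"
  assumes meas: "\<And>k. set_borel_measurable lebesgue I (f k)"
    and summ: "\<And>s. s \<in> I \<Longrightarrow> (\<lambda>k. f k s) summable_on UNIV"
  shows "set_borel_measurable lebesgue I (\<lambda>s. \<Sum>\<^sub>\<infinity>k. f k s)"
  unfolding set_borel_measurable_def
proof (rule borel_measurable_LIMSEQ_metric)
  show "(\<lambda>s. indicator I s *\<^sub>R (\<Sum>k\<in>{- int n..int n}. f k s)) \<in> borel_measurable lebesgue" for n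
    using set_borel_measurable_sum[OF meas] by (simp add: set_borel_measurable_def)
  show "(\<lambda>n. indicator I s *\<^sub>R (\<Sum>k\<in>{- int n..int n}. f k s)) \<longlonglongrightarrow> indicator I s *\<^sub>R (\<Sum>\<^sub>\<infinity>k. f k s)" for s
    using has_sum_imp_symmetric_sums[OF has_sum_infsum[OF summ[of s]]]
    by (cases "s \<in> I") auto
qed

text \<open>
  Dominated convergence along the symmetric partial sums, with the constant \<open>K\<close> as the dominating
  function. In the applications the integrals form a sequence with a Sobolev bound, which makes
  them summable.
\<close>

lemma set_integral_infsum:
  fixes f :: "int \<Rightarrow> real \<Rightarrow> complex"
  assumes I: "I \<in> lmeasurable"
    and meas: "\<And>k. set_borel_measurable lebesgue I (f k)"
    and bound: "\<And>s F. s \<in> I \<Longrightarrow> finite F \<Longrightarrow> (\<Sum>k\<in>F. cmod (f k s)) \<le> K"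
    and summ: "(\<lambda>k. LINT s:I|lebesgue. f k s) summable_on UNIV"
  shows "(LINT s:I|lebesgue. (\<Sum>\<^sub>\<infinity>k. f k s)) = (\<Sum>\<^sub>\<infinity>k. LINT s:I|lebesgue. f k s)"
proof -
  have abs: "(\<lambda>k. f k s) summable_on UNIV" if "s \<in> I" for s
    by (rule abs_summable_summable, rule nonneg_bdd_above_summable_on)
      (use bound[OF that] in \<open>auto simp: bdd_above_def\<close>)
  have K: "norm (f k s) \<le> K" if "s \<in> I" for s k
    using bound[OF that, of "{k}"] by simp
  have intf: "set_integrable lebesgue I (f k)" for k
    using I meas K by (rule set_integrable_bounded)
  have "(\<lambda>n. LINT s|lebesgue. indicator I s *\<^sub>R (\<Sum>k\<in>{- int n..int n}. f k s))
      \<longlonglongrightarrow> (LINT s|lebesgue. indicator I s *\<^sub>R (\<Sum>\<^sub>\<infinity>k. f k s))"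
  proof (rule integral_dominated_convergence)
    show "(\<lambda>s. indicator I s *\<^sub>R (\<Sum>\<^sub>\<infinity>k. f k s)) \<in> borel_measurable lebesgue"
      using set_borel_measurable_infsum[OF meas abs] by (simp add: set_borel_measurable_def)
    show "(\<lambda>s. indicator I s *\<^sub>R (\<Sum>k\<in>{- int n..int n}. f k s)) \<in> borel_measurable lebesgue" for n
      using set_borel_measurable_sum[OF meas] by (simp add: set_borel_measurable_def)
    show "integrable lebesgue (\<lambda>s. indicator I s * K)"
      using I by (intro integrable_mult_left integrable_real_indicator) (auto simp: fmeasurable_def)
    show "AE s in lebesgue. (\<lambda>n. indicator I s *\<^sub>R (\<Sum>k\<in>{- int n..int n}. f k s))
        \<longlonglongrightarrow> indicator I s *\<^sub>R (\<Sum>\<^sub>\<infinity>k. f k s)"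
    proof (rule AE_I2)
      fix s show "(\<lambda>n. indicator I s *\<^sub>R (\<Sum>k\<in>{- int n..int n}. f k s))
          \<longlonglongrightarrow> indicator I s *\<^sub>R (\<Sum>\<^sub>\<infinity>k. f k s)"
        using has_sum_imp_symmetric_sums[OF has_sum_infsum[OF abs[of s]]]
        by (cases "s \<in> I") auto
    qed
    show "AE s in lebesgue. norm (indicator I s *\<^sub>R (\<Sum>k\<in>{- int n..int n}. f k s)) \<le> indicator I s * K" for n
    proof (rule AE_I2)
      fix s show "norm (indicator I s *\<^sub>R (\<Sum>k\<in>{- int n..int n}. f k s)) \<le> indicator I s * K"
        using order_trans[OF norm_sum bound[of s "{- int n..int n}"]] by (cases "s \<in> I") auto
    qed
  qed
  moreover have "(LINT s|lebesgue. indicator I s *\<^sub>R (\<Sum>k\<in>{- int n..int n}. f k s)) =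
      (\<Sum>k\<in>{- int n..int n}. LINT s:I|lebesgue. f k s)" for n
    using intf unfolding set_lebesgue_integral_def set_integrable_def scaleR_sum_right
    by (intro Bochner_Integration.integral_sum) auto
  ultimately have "(\<lambda>n. \<Sum>k\<in>{- int n..int n}. LINT s:I|lebesgue. f k s)
      \<longlonglongrightarrow> (LINT s:I|lebesgue. (\<Sum>\<^sub>\<infinity>k. f k s))"
    by (simp add: set_lebesgue_integral_def)
  moreover have "(\<lambda>n. \<Sum>k\<in>{- int n..int n}. LINT s:I|lebesgue. f k s)
      \<longlonglongrightarrow> (\<Sum>\<^sub>\<infinity>k. LINT s:I|lebesgue. f k s)"
    by (rule has_sum_imp_symmetric_sums[OF has_sum_infsum[OF summ]])
  ultimately show ?thesis by (rule LIMSEQ_unique)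
qed

text \<open>
  Minkowski's integral inequality, by duality: the weighted \<open>\<ell>\<^sup>2\<close> norm \<open>N\<close> of the integrals \<open>z\<close> is
  recovered by pairing with \<open>z\<close> itself, which turns \<open>N\<^sup>2\<close> into the integral of a scalar function
  bounded by \<open>N G\<close>.
\<close>

lemma hs_bound_set_integral:
  fixes g :: "real \<Rightarrow> int \<Rightarrow> complex"
  assumes I: "I \<in> lmeasurable"
    and meas: "\<And>k. set_borel_measurable lebesgue I (\<lambda>s. g s k)"
    and bound: "\<And>s. s \<in> I \<Longrightarrow> hs_bound r (g s) G"
  shows "hs_bound r (\<lambda>k. LINT s:I|lebesgue. g s k) (measure lebesgue I * G)"
  unfolding hs_bound_def
proof (intro allI impI)
  fix F :: "int set" assume F: "finite F"
  \<comment> \<open>\<open>h s\<close> pairs the integrand at time \<open>s\<close> with the integrals \<open>z\<close> in the weighted inner product.\<close>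
  define z where "z k = (LINT s:I|lebesgue. g s k)" for k
  define N where "N = L2_set (\<lambda>k. weight r k * cmod (z k)) F"
  define h where "h s = (\<Sum>k\<in>F. (cnj (z k) * (weight r k)\<^sup>2) * g s k)" for s
  have pt: "weight r k * cmod (g s k) \<le> G" if "s \<in> I" for s k
    using hs_boundD[OF bound[OF that], of "{k}"] weight_pos[of r k] by simp
  have "cmod (g s k) \<le> G / weight r k" if "s \<in> I" for s k
    using pt[OF that, of k] weight_pos[of r k] by (simp add: field_simps)
  with I meas have ig: "set_integrable lebesgue I (\<lambda>s. g s k)" for k
    by (rule set_integrable_bounded)
  have "(LINT s:I|lebesgue. h s) = (\<Sum>k\<in>F. LINT s:I|lebesgue. (cnj (z k) * (weight r k)\<^sup>2) * g s k)"
    using set_integrable_mult_right[OF ig]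
    unfolding h_def set_lebesgue_integral_def set_integrable_def scaleR_sum_right
    by (intro Bochner_Integration.integral_sum) auto
  also have "\<dots> = (\<Sum>k\<in>F. (cnj (z k) * (weight r k)\<^sup>2) * z k)"
    by (simp add: z_def)
  also have "\<dots> = of_real (\<Sum>k\<in>F. (weight r k * cmod (z k))\<^sup>2)"
    by (simp add: power_mult_distrib mult_ac complex_norm_square flip: of_real_power)
  also have "(\<Sum>k\<in>F. (weight r k * cmod (z k))\<^sup>2) = N\<^sup>2"
    by (simp add: N_def L2_set_def sum_nonneg)
  finally have int_h: "(LINT s:I|lebesgue. h s) = of_real (N\<^sup>2)" .
  have h_le: "cmod (h s) \<le> N * G" if s: "s \<in> I" for s
  proof -
    have "cmod (h s) \<le> (\<Sum>k\<in>F. \<bar>weight r k * cmod (z k)\<bar> * \<bar>weight r k * cmod (g s k)\<bar>)"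
      unfolding h_def
      by (rule order_trans[OF norm_sum])
        (simp add: norm_mult abs_mult power2_eq_square mult_ac abs_of_pos[OF weight_pos])
    also have "\<dots> \<le> N * L2_set (\<lambda>k. weight r k * cmod (g s k)) F"
      unfolding N_def by (rule L2_set_mult_ineq)
    also have "\<dots> \<le> N * G"
      using hs_boundD[OF bound[OF s] F] by (intro mult_left_mono) (auto simp: N_def)
    finally show ?thesis .
  qed
  have "cmod (LINT s:I|lebesgue. h s) \<le> measure lebesgue I * (N * G)"
    by (rule norm_set_integral_le[OF I h_le])
  with int_h have *: "N * N \<le> N * (measure lebesgue I * G)"
    by (simp add: power2_eq_square mult_ac norm_mult)
  have "measure lebesgue I * G \<ge> 0"
  proof (cases "I = {}")
    case False
    then show ?thesis using hs_bound_nonneg[OF bound] by fastforce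
  qed simp
  moreover have "N \<ge> 0" by (simp add: N_def)
  ultimately have "N \<le> measure lebesgue I * G"
    using * by (cases "N = 0") (auto simp: mult_le_cancel_left)
  then show "L2_set (\<lambda>k. weight r k * cmod (LINT s:I|lebesgue. g s k)) F \<le> measure lebesgue I * G"
    by (simp add: N_def z_def)
qed

section \<open>Absolutely convergent Fourier series\<close>

lemma continuous_imp_lebesgue_measurable:
  fixes f :: "real \<Rightarrow> complex"
  assumes "continuous_on UNIV f"
  shows "f \<in> borel_measurable lebesgue"
  using measurable_completion[of f lborel borel] borel_measurable_continuous_onI[OF assms] by simp

lemma set_borel_measurable_continuous:
  fixes f :: "real \<Rightarrow> complex"
  assumes "continuous_on UNIV f" "I \<in> sets lebesgue"
  shows "set_borel_measurable lebesgue I f"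
  unfolding set_borel_measurable_def
  by (intro borel_measurable_scaleR borel_measurable_indicator assms continuous_imp_lebesgue_measurable)

lemma integral_cis:
  fixes c a b :: real
  assumes "c \<noteq> 0" "a \<le> b"
  shows "(LINT s:{a..b}|lebesgue. cis (c * s)) = (cis (c * b) - cis (c * a)) / (\<i> * of_real c)"
proof -
  have "((\<lambda>s. cis (c * s)) has_integral
      cis (c * b) / (\<i> * of_real c) - cis (c * a) / (\<i> * of_real c)) {a..b}"
  proof (rule fundamental_theorem_of_calculus[OF assms(2)])
    fix s assume "s \<in> {a..b}"
    have "((\<lambda>z. exp (\<i> * of_real c * z) / (\<i> * of_real c)) has_field_derivative
        exp (\<i> * of_real c * of_real s)) (at (of_real s))"
      using assms(1) by (auto intro!: derivative_eq_intros)
    from has_vector_derivative_real_field[OF this, of "{a..b}"]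
    show "((\<lambda>s. cis (c * s) / (\<i> * of_real c)) has_vector_derivative cis (c * s)) (at s within {a..b})"
      by (simp add: cis_conv_exp mult_ac)
  qed
  moreover have "set_integrable lebesgue {a..b} (\<lambda>s. cis (c * s))"
    by (rule set_integrable_bounded[where K = 1])
      (auto intro!: set_borel_measurable_continuous continuous_intros)
  ultimately show ?thesis
    using assms by (simp add: set_lebesgue_integral_eq_integral integral_unique diff_divide_distrib)
qed

lemma integral_cis_int:
  "(LINT x:{0..2*pi}|lebesgue. cis (of_int n * x)) = (if n = 0 then 2 * of_real pi else 0)"
proof (cases "n = 0")
  case True
  then show ?thesis by (simp add: set_lebesgue_integral_def scaleR_conv_of_real)
next
  case False
  have "cis (real_of_int n * (2 * pi)) = 1"
    using cis_multiple_2pi[of "real_of_int n"] by (simp add: mult_ac)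
  with False show ?thesis
    by (subst integral_cis) auto
qed

definition trig_series :: "(int \<Rightarrow> complex) \<Rightarrow> real \<Rightarrow> complex" where
  "trig_series a x = (\<Sum>\<^sub>\<infinity>k. a k * cis (of_int k * x))"

lemma trig_series_has_sum:
  assumes "(\<lambda>k. cmod (a k)) summable_on UNIV"
  shows "((\<lambda>k. a k * cis (of_int k * x)) has_sum trig_series a x) UNIV"
  unfolding trig_series_def
  by (rule has_sum_infsum, rule abs_summable_summable) (use assms in \<open>simp add: norm_mult\<close>)

lemma norm_trig_series_le:
  assumes "(\<lambda>k. cmod (a k)) summable_on UNIV"
  shows "cmod (trig_series a x) \<le> (\<Sum>\<^sub>\<infinity>k. cmod (a k))"
  unfolding trig_series_def
  using norm_infsum_bound[of "\<lambda>k. a k * cis (of_int k * x)" UNIV] assms by (simp add: norm_mult)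

lemma trig_series_periodic: "trig_series a (x + 2 * pi) = trig_series a x"
proof -
  have "cis (real_of_int k * (x + 2 * pi)) = cis (real_of_int k * x)" for k
    using cis_multiple_2pi[of "real_of_int k"] by (simp add: distrib_left mult_ac flip: cis_mult)
  then show ?thesis by (simp add: trig_series_def)
qed

lemma trig_series_measurable:
  assumes "(\<lambda>k. cmod (a k)) summable_on UNIV"
  shows "trig_series a \<in> borel_measurable lebesgue"
proof (rule borel_measurable_LIMSEQ_metric)
  show "(\<lambda>x. \<Sum>k\<in>{- int n..int n}. a k * cis (of_int k * x)) \<in> borel_measurable lebesgue" for n
    by (intro continuous_imp_lebesgue_measurable continuous_intros)
  show "(\<lambda>n. \<Sum>k\<in>{- int n..int n}. a k * cis (of_int k * x)) \<longlonglongrightarrow> trig_series a x" for x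
    by (rule has_sum_imp_symmetric_sums[OF trig_series_has_sum[OF assms]])
qed

lemma fourier_coeff_trig_series:
  assumes a: "(\<lambda>k. cmod (a k)) summable_on UNIV"
  shows "fourier_coeff (trig_series a) k = a k"
proof -
  let ?I = "{0..2 * pi}"
  let ?f = "\<lambda>j x. a j * cis (of_int j * x) * cis (- (of_int k * x))"
  have f: "?f j x = a j * cis (of_int (j - k) * x)" for j x
    by (simp add: cis_mult algebra_simps)
  have int_f: "(LINT x:?I|lebesgue. ?f j x) = (if j = k then 2 * of_real pi * a k else 0)" for j
    unfolding f set_integral_mult_right integral_cis_int by auto
  have "(LINT x:?I|lebesgue. trig_series a x * cis (- (of_int k * x))) =
      (LINT x:?I|lebesgue. (\<Sum>\<^sub>\<infinity>j. ?f j x))"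
    using trig_series_has_sum[OF a] unfolding trig_series_def
    by (simp add: infsum_cmult_left has_sum_iff)
  also have "\<dots> = (\<Sum>\<^sub>\<infinity>j. LINT x:?I|lebesgue. ?f j x)"
  proof (rule set_integral_infsum)
    show "set_borel_measurable lebesgue ?I (?f j)" for j
      by (intro set_borel_measurable_continuous continuous_intros) auto
    show "(\<Sum>j\<in>F. cmod (?f j x)) \<le> (\<Sum>\<^sub>\<infinity>j. cmod (a j))" if "finite F" for F x
      using finite_sum_le_infsum[OF a that] by (simp add: norm_mult)
    show "(\<lambda>j. LINT x:?I|lebesgue. ?f j x) summable_on UNIV"
      unfolding int_f by (rule finite_nonzero_values_imp_summable_on) (simp add: finite_subset[of _ "{k}"] subset_eq)
  qed auto
  also have "\<dots> = 2 * of_real pi * a k"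
    unfolding int_f by (rule infsumI, rule has_sum_finite_neutralI[of "{k}"]) auto
  finally show ?thesis by (simp add: fourier_coeff_def)
qed

text \<open>
  Fubini for the absolutely summable double series, regrouped along \<open>k = j + l\<close>.
\<close>

lemma trig_series_mult:
  assumes a: "(\<lambda>k. cmod (a k)) summable_on UNIV" and b: "(\<lambda>k. cmod (b k)) summable_on UNIV"
  shows "trig_series a x * trig_series b x = trig_series (conv a b) x"
proof -
  define f where "f = (\<lambda>(j, l). a j * b l * cis (of_int (j + l) * x))"
  have fe: "f (j, l) = (a j * cis (of_int j * x)) * (b l * cis (of_int l * x))" for j l
  proof -
    have "cis (of_int (j + l) * x) = cis (of_int j * x) * cis (of_int l * x)"
      by (simp add: cis_mult distrib_right)
    then show ?thesis by (simp add: f_def)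
  qed
  have "(\<lambda>p. norm (f p)) summable_on (UNIV \<times> UNIV)"
  proof (rule summable_on_SigmaI)
    show "((\<lambda>l. norm (f (j, l))) has_sum cmod (a j) * (\<Sum>\<^sub>\<infinity>l. cmod (b l))) UNIV" for j
      using has_sum_cmult_right[OF has_sum_infsum[OF b], of "cmod (a j)"]
      by (simp add: f_def norm_mult)
    show "(\<lambda>j. cmod (a j) * (\<Sum>\<^sub>\<infinity>l. cmod (b l))) summable_on UNIV"
      using a by (rule summable_on_cmult_left)
  qed auto
  then have f: "f summable_on (UNIV \<times> UNIV)" by (rule abs_summable_summable)
  have "(\<Sum>\<^sub>\<infinity>p\<in>UNIV \<times> UNIV. f p) = (\<Sum>\<^sub>\<infinity>j. \<Sum>\<^sub>\<infinity>l. f (j, l))"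
    using infsum_Sigma_banach[OF f] by simp
  also have "\<dots> = (\<Sum>\<^sub>\<infinity>j. (a j * cis (of_int j * x)) * trig_series b x)"
    unfolding fe trig_series_def
    using trig_series_has_sum[OF b] by (simp add: infsum_cmult_right has_sum_iff)
  also have "\<dots> = trig_series a x * trig_series b x"
    using trig_series_has_sum[OF a, of x] by (simp add: infsum_cmult_left has_sum_iff)
  finally have 1: "(\<Sum>\<^sub>\<infinity>p\<in>UNIV \<times> UNIV. f p) = trig_series a x * trig_series b x" .
  define \<pi> :: "int \<times> int \<Rightarrow> int \<times> int" where "\<pi> = (\<lambda>(k, j). (j, k - j))"
  have bij: "bij_betw \<pi> (UNIV \<times> UNIV) (UNIV \<times> UNIV)"
    by (rule bij_betw_byWitness[where f' = "\<lambda>(j, l). (j + l, j)"]) (auto simp: \<pi>_def)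
  have "(\<lambda>p. f (\<pi> p)) summable_on (UNIV \<times> UNIV)"
    using summable_on_reindex_bij_betw[OF bij] f by blast
  from infsum_Sigma_banach[OF this] infsum_reindex_bij_betw[OF bij, of f]
  have "(\<Sum>\<^sub>\<infinity>p\<in>UNIV \<times> UNIV. f p) = (\<Sum>\<^sub>\<infinity>k. \<Sum>\<^sub>\<infinity>j. f (\<pi> (k, j)))"
    by simp
  also have "\<dots> = trig_series (conv a b) x"
    unfolding trig_series_def twisted_conv_def f_def \<pi>_def
    by (simp add: infsum_cmult_left')
  finally show ?thesis using 1 by simp
qed

section \<open>Uniqueness of Fourier coefficients\<close>

definition fourier_null :: "(real \<Rightarrow> complex) \<Rightarrow> bool" where
  "fourier_null h \<longleftrightarrow> set_integrable lebesgue {0..2 * pi} h \<and> (\<forall>k. fourier_coeff h k = 0)"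

lemma set_integrable_mult_bounded_continuous:
  fixes g h :: "real \<Rightarrow> complex"
  assumes h: "set_integrable lebesgue I h" and g: "continuous_on UNIV g" "\<And>x. x \<in> I \<Longrightarrow> cmod (g x) \<le> K"
  shows "set_integrable lebesgue I (\<lambda>x. g x * h x)"
proof (rule set_integrable_bound)
  show "set_integrable lebesgue I (\<lambda>x. of_real K * h x)" using h by simp
  have "set_borel_measurable lebesgue I h"
    using h by (simp add: set_integrable_def set_borel_measurable_def)
  then show "set_borel_measurable lebesgue I (\<lambda>x. g x * h x)"
    using g(1) by (rule set_borel_measurable_mult_continuous)
  show "AE x in lebesgue. x \<in> I \<longrightarrow> norm (g x * h x) \<le> norm (of_real K * h x)"
    using g(2) by (auto simp: norm_mult intro!: AE_I2 mult_right_mono intro: order_trans[OF _ abs_ge_self])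
qed

lemma set_integrable_mult_cis:
  assumes "set_integrable lebesgue I h"
  shows "set_integrable lebesgue I (\<lambda>x. cis (c * x) * h x)"
  by (rule set_integrable_mult_bounded_continuous[OF assms, where K = 1]) (auto intro!: continuous_intros)

lemma fourier_coeff_add:
  assumes "set_integrable lebesgue {0..2 * pi} f" "set_integrable lebesgue {0..2 * pi} g"
  shows "fourier_coeff (\<lambda>x. f x + g x) k = fourier_coeff f k + fourier_coeff g k"
  using set_integral_add(2)[OF set_integrable_mult_cis[OF assms(1), of "- of_int k"]
      set_integrable_mult_cis[OF assms(2), of "- of_int k"]]
  by (simp add: fourier_coeff_def distrib_left distrib_right add_divide_distrib mult.commute[of "cis _"])

lemma fourier_coeff_cmult: "fourier_coeff (\<lambda>x. c * f x) k = c * fourier_coeff f k"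
  unfolding fourier_coeff_def by (simp add: mult.assoc)

lemma fourier_coeff_diff:
  assumes "set_integrable lebesgue {0..2 * pi} f" "set_integrable lebesgue {0..2 * pi} g"
  shows "fourier_coeff (\<lambda>x. f x - g x) k = fourier_coeff f k - fourier_coeff g k"
  using set_integral_diff(2)[OF set_integrable_mult_cis[OF assms(1), of "- of_int k"]
      set_integrable_mult_cis[OF assms(2), of "- of_int k"]]
  by (simp add: fourier_coeff_def right_diff_distrib left_diff_distrib diff_divide_distrib mult.commute[of "cis _"])

lemma fourier_null_add: "fourier_null g \<Longrightarrow> fourier_null h \<Longrightarrow> fourier_null (\<lambda>x. g x + h x)"
  by (auto simp: fourier_null_def fourier_coeff_add)

lemma fourier_null_cmult: "fourier_null h \<Longrightarrow> fourier_null (\<lambda>x. c * h x)"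
  by (auto simp: fourier_null_def fourier_coeff_cmult)

lemma fourier_null_shift:
  assumes "fourier_null h"
  shows "fourier_null (\<lambda>x. cis (of_int n * x) * h x)"
proof -
  have "fourier_coeff (\<lambda>x. cis (of_int n * x) * h x) k = fourier_coeff h (k - n)" for k
  proof -
    have "cis (of_int n * x) * h x * cis (- (of_int k * x)) = h x * cis (- (of_int (k - n) * x))" for x
    proof -
      have "cis (of_int n * x) * cis (- (of_int k * x)) = cis (- (of_int (k - n) * x))"
        by (simp add: cis_mult left_diff_distrib)
      then show ?thesis by (metis mult.assoc mult.commute)
    qed
    then show ?thesis unfolding fourier_coeff_def by presburger
  qed
  with assms show ?thesis by (simp add: fourier_null_def set_integrable_mult_cis)
qed

text \<open>
  The functions with vanishing Fourier coefficients form a module over the polynomials in \<open>cos x\<close>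
  and \<open>sin x\<close>: a linear form in these is a combination of \<open>cis x\<close> and \<open>cis (- x)\<close>, which only
  shift the coefficients, and products are handled by applying the claim twice.
\<close>

lemma fourier_null_mult_polynomial:
  assumes "real_polynomial_function p" "fourier_null h"
  shows "fourier_null (\<lambda>x. of_real (p (cis x)) * h x)"
  using assms
proof (induction p arbitrary: h rule: real_polynomial_function.induct)
  case (linear f)
  interpret bounded_linear f by fact
  define \<alpha> where "\<alpha> = (of_real (f 1) - \<i> * of_real (f \<i>)) / 2"
  define \<beta> where "\<beta> = (of_real (f 1) + \<i> * of_real (f \<i>)) / 2"
  have "of_real (f (cis x)) * h x = \<alpha> * (cis (of_int 1 * x) * h x) + \<beta> * (cis (of_int (- 1) * x) * h x)" for x
  proof -
    have "cis x = cos x *\<^sub>R 1 + sin x *\<^sub>R \<i>"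
      by (simp add: complex_eq_iff)
    then have "f (cis x) = cos x * f 1 + sin x * f \<i>"
      by (simp only: add scaleR real_scaleR_def)
    then have "complex_of_real (f (cis x)) = \<alpha> * cis x + \<beta> * cis (- x)"
      by (simp add: \<alpha>_def \<beta>_def complex_eq_iff field_simps)
    then show ?thesis by (simp add: algebra_simps)
  qed
  then show ?case
    unfolding \<open>\<And>x. of_real (f (cis x)) * h x = _\<close>
    by (intro fourier_null_add fourier_null_cmult fourier_null_shift \<open>fourier_null h\<close>)
next
  case (const c)
  then show ?case by (rule fourier_null_cmult)
next
  case (add f g)
  then show ?case
    using fourier_null_add[OF add.IH(1)[OF add.prems] add.IH(2)[OF add.prems]]
    by (simp add: algebra_simps)
next
  case (mult f g)
  from mult.IH(1)[OF mult.IH(2)[OF mult.prems]] show ?case by (simp add: mult.assoc)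
qed

lemma fourier_null_integral_0:
  assumes "fourier_null h"
  shows "(LINT x:{0..2 * pi}|lebesgue. h x) = 0"
  using assms by (auto simp: fourier_null_def fourier_coeff_def dest!: spec[of _ 0])

text \<open>
  The Stone-Weierstrass theorem on the unit circle.
\<close>

lemma fourier_null_integral_continuous:
  fixes g :: "complex \<Rightarrow> real"
  assumes h: "fourier_null h" and g: "continuous_on UNIV g"
  shows "(LINT x:{0..2 * pi}|lebesgue. of_real (g (cis x)) * h x) = 0"
proof -
  let ?I = "{0..2 * pi}"
  have hi: "set_integrable lebesgue ?I h" using h by (simp add: fourier_null_def)
  define N where "N = (LINT x:?I|lebesgue. cmod (h x))"
  have N: "N \<ge> 0" unfolding N_def set_lebesgue_integral_def by (rule Bochner_Integration.integral_nonneg) auto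
  have hn: "set_integrable lebesgue ?I (\<lambda>x. cmod (h x))" using hi by (rule set_integrable_norm)
  have gi: "set_integrable lebesgue ?I (\<lambda>x. of_real (f (cis x)) * h x)" if f: "continuous_on UNIV f" for f :: "complex \<Rightarrow> real"
  proof -
    have "compact (f ` sphere 0 1)"
      using f by (intro compact_continuous_image) (auto intro: continuous_on_subset)
    then obtain K where K: "\<And>z. z \<in> sphere 0 1 \<Longrightarrow> norm (f z) \<le> K"
      using compact_imp_bounded[of "f ` sphere 0 1"] unfolding bounded_iff by blast
    show ?thesis
      by (rule set_integrable_mult_bounded_continuous[OF hi, where K = K])
        (use K in \<open>auto intro!: continuous_intros continuous_on_compose2[OF f]\<close>)
  qed
  have le: "cmod (LINT x:?I|lebesgue. of_real (g (cis x)) * h x) \<le> e * N" if e: "e > 0" for e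
  proof -
    obtain p where p: "real_polynomial_function p"
      and pe: "\<And>z. z \<in> sphere 0 1 \<Longrightarrow> \<bar>g z - p z\<bar> < e"
      using Stone_Weierstrass_real_polynomial_function[of "sphere (0::complex) 1" g e] g e
      by (metis compact_sphere continuous_on_subset subset_UNIV)
    have pc: "continuous_on UNIV p"
      using p continuous_on_polymonial_function real_polynomial_function_eq by blast
    have "(LINT x:?I|lebesgue. of_real (g (cis x)) * h x) =
       (LINT x:?I|lebesgue. of_real (g (cis x)) * h x - of_real (p (cis x)) * h x)"
      using fourier_null_integral_0[OF fourier_null_mult_polynomial[OF p h]] gi[OF g] gi[OF pc]
      by (subst set_integral_diff(2)) auto
    also have "cmod \<dots> \<le> (LINT x:?I|lebesgue. cmod (of_real (g (cis x)) * h x - of_real (p (cis x)) * h x))"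
      using gi[OF g] gi[OF pc] by (intro set_integral_norm_bound set_integral_diff)
    also have "\<dots> \<le> (LINT x:?I|lebesgue. e * cmod (h x))"
    proof (rule set_integral_mono)
      fix x
      have "cmod (of_real (g (cis x)) * h x - of_real (p (cis x)) * h x) = \<bar>g (cis x) - p (cis x)\<bar> * cmod (h x)"
        by (simp flip: left_diff_distrib norm_of_real[where ?'a = complex] add: norm_mult)
      also have "\<dots> \<le> e * cmod (h x)"
        using pe[of "cis x"] by (intro mult_right_mono) auto
      finally show "cmod (of_real (g (cis x)) * h x - of_real (p (cis x)) * h x) \<le> e * cmod (h x)" .
    qed (use gi[OF g] gi[OF pc] hn in \<open>auto intro!: set_integrable_norm set_integral_diff\<close>)
    also have "\<dots> = e * N" by (simp add: N_def)
    finally show ?thesis .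
  qed
  have "cmod (LINT x:?I|lebesgue. of_real (g (cis x)) * h x) \<le> 0"
  proof (rule field_le_epsilon)
    fix e :: real assume e: "e > 0"
    have "e / (N + 1) * N \<le> e" using e N by (simp add: field_simps)
    with le[of "e / (N + 1)"] e N show "cmod (LINT x:?I|lebesgue. of_real (g (cis x)) * h x) \<le> 0 + e"
      by (simp add: add_nonneg_pos)
  qed
  then show ?thesis by simp
qed

lemma two_pi_pos: "2 * pi > 0"
  by simp

text \<open>
  One of the two points has to lie in the interior of the period, as \<open>0\<close> and \<open>2 pi\<close> have the same
  image.
\<close>

lemma cis_inj_on_period:
  assumes "cis x = cis y" "0 < x" "x < 2 * pi" "0 \<le> y" "y \<le> 2 * pi"
  shows "x = y"
proof -
  have "cos x = cos y \<and> sin x = sin y" using assms(1) by (simp add: complex_eq_iff)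
  then obtain n :: int where n: "x = y + 2 * pi * n"
    using sin_cos_eq_iff[of x y] by auto
  then have "2 * pi * real_of_int n < 2 * pi * 1" "2 * pi * (-1) < 2 * pi * real_of_int n"
    using assms n by linarith+
  then have "real_of_int n < 1" "- 1 < real_of_int n"
    unfolding mult_less_cancel_left_pos[OF two_pi_pos] .
  then have "n < 1" "- 1 < n" by linarith+
  then show ?thesis using n by simp
qed

text \<open>
  The indicator of a closed set is a limit of continuous functions of the distance. The distance
  is taken on the circle, to the image of the set, and the end points, which the circle
  identifies, form a null set.
\<close>

lemma fourier_null_integral_closed:
  assumes h: "fourier_null h" and A: "closed A"
  shows "(LINT x:{0..2 * pi} \<inter> A|lebesgue. h x) = 0"
proof (cases "{0..2 * pi} \<inter> A = {}")
  case True
  then show ?thesis by (simp add: set_lebesgue_integral_def)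
next
  case ne: False
  let ?I = "{0..2 * pi}"
  have hi: "set_integrable lebesgue ?I h" using h by (simp add: fourier_null_def)
  define E where "E = cis ` (?I \<inter> A)"
  have "compact (?I \<inter> A)" using A by (intro compact_Int_closed) auto
  then have "compact E" unfolding E_def by (intro compact_continuous_image continuous_intros)
  then have E: "closed E" "E \<noteq> {}" using ne by (auto simp: E_def compact_imp_closed)
  \<comment> \<open>Hat functions decreasing to the indicator of \<open>E\<close>.\<close>
  define g :: "nat \<Rightarrow> complex \<Rightarrow> real" where "g n z = max 0 (1 - real n * infdist z E)" for n z
  have g: "continuous_on UNIV (g n)" for n
    unfolding g_def by (intro continuous_intros)
  have "(\<lambda>n. LINT x|lebesgue. indicator ?I x *\<^sub>R (of_real (g n (cis x)) * h x)) \<longlonglongrightarrow>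
      (LINT x|lebesgue. indicator (?I \<inter> A) x *\<^sub>R h x)"
  proof (rule integral_dominated_convergence)
    have "integrable lebesgue (\<lambda>x. indicator ?I x *\<^sub>R h x)" using hi by (simp add: set_integrable_def)
    then show w: "integrable lebesgue (\<lambda>x. norm (indicator ?I x *\<^sub>R h x))" by (rule integrable_norm)
    have m: "(\<lambda>x. indicator ?I x *\<^sub>R h x) \<in> borel_measurable lebesgue"
      using hi by (auto simp: set_integrable_def)
    have "(\<lambda>x. indicator A x *\<^sub>R (indicator ?I x *\<^sub>R h x)) \<in> borel_measurable lebesgue"
      using A by (intro borel_measurable_scaleR borel_measurable_indicator m) auto
    moreover have "(\<lambda>x. indicator A x *\<^sub>R (indicator ?I x *\<^sub>R h x)) = (\<lambda>x. indicator (?I \<inter> A) x *\<^sub>R h x)"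
      by (auto simp: indicator_def fun_eq_iff)
    ultimately show "(\<lambda>x. indicator (?I \<inter> A) x *\<^sub>R h x) \<in> borel_measurable lebesgue" by simp
    show "(\<lambda>x. indicator ?I x *\<^sub>R (of_real (g n (cis x)) * h x)) \<in> borel_measurable lebesgue" for n
    proof -
      have "(\<lambda>x. complex_of_real (g n (cis x))) \<in> borel_measurable lebesgue"
        by (intro continuous_imp_lebesgue_measurable continuous_intros
            continuous_on_compose2[OF g]) auto
      then have "(\<lambda>x. complex_of_real (g n (cis x)) * (indicator ?I x *\<^sub>R h x)) \<in> borel_measurable lebesgue"
        using m by (rule borel_measurable_times)
      then show ?thesis by simp
    qed
    show "AE x in lebesgue. norm (indicator ?I x *\<^sub>R (of_real (g n (cis x)) * h x)) \<le> norm (indicator ?I x *\<^sub>R h x)" for n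
    proof (rule AE_I2)
      fix x
      have "\<bar>g n (cis x)\<bar> \<le> 1" by (auto simp: g_def infdist_nonneg)
      then show "norm (indicator ?I x *\<^sub>R (of_real (g n (cis x)) * h x)) \<le> norm (indicator ?I x *\<^sub>R h x)"
        by (auto simp: norm_mult indicator_def mult_left_le_one_le)
    qed
    have "AE x in lebesgue. x \<noteq> 0" "AE x in lebesgue. x \<noteq> 2 * pi"
      by (auto intro!: AE_completion AE_lborel_singleton)
    then show "AE x in lebesgue. (\<lambda>n. indicator ?I x *\<^sub>R (of_real (g n (cis x)) * h x)) \<longlonglongrightarrow> indicator (?I \<inter> A) x *\<^sub>R h x"
    proof eventually_elim
      case (elim x)
      show ?case
      proof (cases "x \<in> ?I")
        case xI: True
        have "(\<lambda>n. g n (cis x)) \<longlonglongrightarrow> indicator A x"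
        proof (cases "x \<in> A")
          case True
          then have "cis x \<in> E" using xI by (auto simp: E_def)
          then show ?thesis using True by (simp add: g_def)
        next
          case False
          have "cis x \<notin> E"
            using False xI elim cis_inj_on_period[of x] by (auto simp: E_def)
          then have pos: "infdist (cis x) E > 0"
            using E in_closed_iff_infdist_zero[of E "cis x"] infdist_nonneg[of "cis x" E] by linarith
          then obtain n0 :: nat where n0: "n0 * infdist (cis x) E > 1"
            using ex_less_of_nat_mult by blast
          have "g n (cis x) = 0" if "n \<ge> n0" for n
          proof -
            have "real n0 * infdist (cis x) E \<le> real n * infdist (cis x) E"
              using that pos by (intro mult_right_mono) auto
            with n0 show ?thesis by (simp add: g_def)
          qed
          then have "(\<lambda>n. g n (cis x)) \<longlonglongrightarrow> 0"
            by (intro tendsto_eventually) (auto simp: eventually_sequentially)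
          then show ?thesis using False by simp
        qed
        then have "(\<lambda>n. complex_of_real (g n (cis x)) * h x) \<longlonglongrightarrow> of_real (indicator A x) * h x"
          by (intro tendsto_intros)
        then show ?thesis using xI by (cases "x \<in> A") auto
      qed auto
    qed
  qed
  moreover have "(LINT x|lebesgue. indicator ?I x *\<^sub>R (of_real (g n (cis x)) * h x)) = 0" for n
    using fourier_null_integral_continuous[OF h g[of n]] by (simp add: set_lebesgue_integral_def)
  ultimately show ?thesis
    by (simp add: set_lebesgue_integral_def LIMSEQ_const_iff)
qed

text \<open>
  Closed sets are stable under intersection and generate the Borel sets, so Dynkin's \<open>\<pi>\<close>-\<open>\<lambda>\<close>
  argument applies.
\<close>

lemma fourier_null_integral_borel:
  assumes h: "fourier_null h" and A: "A \<in> sets borel"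
  shows "(LINT x:{0..2 * pi} \<inter> A|lebesgue. h x) = 0"
proof -
  let ?I = "{0..2 * pi}"
  have hi: "set_integrable lebesgue ?I h" using h by (simp add: fourier_null_def)
  have sub: "set_integrable lebesgue (?I \<inter> A) h" if "A \<in> sets borel" for A
    using hi by (rule set_integrable_subset) (use that in auto)
  have "Int_stable (Collect (closed :: real set \<Rightarrow> bool))"
    by (auto simp: Int_stable_def)
  moreover have "Collect closed \<subseteq> Pow (UNIV :: real set)" by simp
  moreover have "A \<in> sigma_sets UNIV (Collect closed)"
    using A by (simp add: borel_eq_closed)
  ultimately show ?thesis
  proof (induction A rule: sigma_sets_induct_disjoint)
    case (basic A)
    then show ?case using fourier_null_integral_closed[OF h] by simp
  next
    case empty
    show ?case by (simp add: set_lebesgue_integral_def)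
  next
    case (compl A)
    then have "A \<in> sets borel" by (simp add: borel_eq_closed)
    have "(LINT x:?I|lebesgue. h x) = (LINT x:(?I \<inter> A) \<union> (?I \<inter> (UNIV - A))|lebesgue. h x)"
      by (rule arg_cong[where f = "\<lambda>S. set_lebesgue_integral lebesgue S h"]) auto
    also have "\<dots> = (LINT x:(?I \<inter> A)|lebesgue. h x) + (LINT x:(?I \<inter> (UNIV - A))|lebesgue. h x)"
      using \<open>A \<in> sets borel\<close> by (intro set_integral_Un sub) auto
    finally show ?case using compl fourier_null_integral_0[OF h] by simp
  next
    case (union A)
    then have A: "A i \<in> sets borel" for i by (auto simp: borel_eq_closed)
    have "(LINT x:(\<Union>i. ?I \<inter> A i)|lebesgue. h x) = (\<Sum>i. (LINT x:(?I \<inter> A i)|lebesgue. h x))"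
    proof (rule lebesgue_integral_countable_add)
      show "set_integrable lebesgue (\<Union>i. ?I \<inter> A i) h"
        using hi by (rule set_integrable_subset) (use A in \<open>auto intro!: sets.countable_UN sets.Int\<close>)
      show "?I \<inter> A i \<in> sets lebesgue" for i using A by auto
      show "(?I \<inter> A i) \<inter> (?I \<inter> A j) = {}" if "i \<noteq> j" for i j
        using union(1) that by (auto simp: disjoint_family_on_def)
    qed
    then show ?case using union by simp
  qed
qed

lemma sigma_finite_lebesgue: "sigma_finite_measure (lebesgue :: real measure)"
proof
  show "\<exists>A. countable A \<and> A \<subseteq> sets lebesgue \<and> \<Union> A = space (lebesgue :: real measure) \<and>
      (\<forall>a\<in>A. emeasure lebesgue a \<noteq> \<infinity>)"
  proof (intro exI[of _ "range (\<lambda>n::nat. {- real n..real n})"] conjI)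
    have "\<exists>n. x \<in> {- real n..real n}" for x :: real
      using real_arch_simple[of "\<bar>x\<bar>"] by (metis abs_le_iff atLeastAtMost_iff minus_le_iff)
    then show "\<Union> (range (\<lambda>n::nat. {- real n..real n})) = space lebesgue" by auto
  qed auto
qed

text \<open>
  Uniqueness of Fourier coefficients for integrable functions: all integrals over measurable sets
  vanish.
\<close>

lemma fourier_null_imp_AE_0:
  assumes h: "fourier_null h"
  shows "AE x in lebesgue. x \<in> {0..2 * pi} \<longrightarrow> h x = 0"
proof -
  let ?I = "{0..2 * pi}"
  have hi: "integrable lebesgue (\<lambda>x. indicator ?I x *\<^sub>R h x)"
    using h by (simp add: fourier_null_def set_integrable_def)
  have "AE x in lebesgue. indicator ?I x *\<^sub>R h x = 0"
  proof (rule sigma_finite_measure.density_zero[OF sigma_finite_lebesgue hi])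
    fix A :: "real set" assume "A \<in> sets lebesgue"
    then obtain S N N' where A: "A = S \<union> N" "N \<subseteq> N'" "N' \<in> null_sets lborel" "S \<in> sets borel"
      by (auto elim!: sets_completionE)
    have nN: "AE x in lebesgue. x \<notin> N'"
      using A(3) by (intro AE_completion AE_not_in)
    have "(LINT x:A|lebesgue. indicator ?I x *\<^sub>R h x) = (LINT x:?I \<inter> S|lebesgue. h x)"
      unfolding set_lebesgue_integral_def
    proof (rule integral_cong_AE)
      have "(\<lambda>x. indicator B x *\<^sub>R (indicator ?I x *\<^sub>R h x)) \<in> borel_measurable lebesgue" if "B \<in> sets lebesgue" for B
        using that borel_measurable_integrable[OF hi]
        by (rule borel_measurable_scaleR[OF borel_measurable_indicator])
      from this[of S] this[OF \<open>A \<in> sets lebesgue\<close>] A(4)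
      show "(\<lambda>x. indicator A x *\<^sub>R (indicator ?I x *\<^sub>R h x)) \<in> borel_measurable lebesgue"
        "(\<lambda>x. indicator (?I \<inter> S) x *\<^sub>R h x) \<in> borel_measurable lebesgue"
        by (auto simp: indicator_inter_arith mult.commute)
      show "AE x in lebesgue. indicator A x *\<^sub>R (indicator ?I x *\<^sub>R h x) = indicator (?I \<inter> S) x *\<^sub>R h x"
        using nN by eventually_elim (use A in \<open>auto simp: indicator_def\<close>)
    qed
    also have "\<dots> = 0" by (rule fourier_null_integral_borel[OF h A(4)])
    finally show "(LINT x:A|lebesgue. indicator ?I x *\<^sub>R h x) = 0" .
  qed
  then show ?thesis by eventually_elim (auto simp: indicator_def split: if_splits)
qed

section \<open>Sobolev functions and their coefficients\<close>

lemma sobolev_hs_bound: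
  assumes "f \<in> sobolev r"
  shows "hs_bound r (fourier_coeff f) (sobolev_norm r f)"
proof -
  let ?g = "\<lambda>k::int. (1 + \<bar>of_int k\<bar>) powr (2 * r) * (cmod (fourier_coeff f k))\<^sup>2"
  have s: "?g summable_on UNIV" using assms by (simp add: sobolev_def)
  have nn: "0 \<le> (\<Sum>\<^sub>\<infinity>k. ?g k)" by (rule infsum_nonneg) auto
  show ?thesis
    unfolding sobolev_norm_def
  proof (subst hs_bound_iff_sum, use nn in simp, intro allI impI)
    fix F :: "int set" assume "finite F"
    then have "(\<Sum>k\<in>F. ?g k) \<le> (\<Sum>\<^sub>\<infinity>k. ?g k)"
      by (intro finite_sum_le_infsum s) auto
    then show "(\<Sum>k\<in>F. (weight r k)\<^sup>2 * (cmod (fourier_coeff f k))\<^sup>2) \<le> (sqrt (\<Sum>\<^sub>\<infinity>k. ?g k))\<^sup>2"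
      using nn by (simp add: weight_sq)
  qed
qed

lemma hs_bound_imp_summable:
  assumes "hs_bound r a X"
  shows "(\<lambda>k::int. (1 + \<bar>of_int k\<bar>) powr (2 * r) * (cmod (a k))\<^sup>2) summable_on UNIV"
proof (rule nonneg_bdd_above_summable_on)
  show "bdd_above (sum (\<lambda>k::int. (1 + \<bar>of_int k\<bar>) powr (2 * r) * (cmod (a k))\<^sup>2) ` {F. F \<subseteq> UNIV \<and> finite F})"
    using assms[unfolded hs_bound_iff_sum[OF hs_bound_nonneg[OF assms]] weight_sq]
    by (intro bdd_aboveI2[where M = "X\<^sup>2"]) auto
qed auto

lemma sobolev_norm_le:
  assumes "hs_bound r (fourier_coeff f) X"
  shows "sobolev_norm r f \<le> X"
proof -
  have X: "X \<ge> 0" using assms by (rule hs_bound_nonneg)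
  have "(\<Sum>\<^sub>\<infinity>k::int. (1 + \<bar>of_int k\<bar>) powr (2 * r) * (cmod (fourier_coeff f k))\<^sup>2) \<le> X\<^sup>2"
    using assms[unfolded hs_bound_iff_sum[OF X] weight_sq]
    by (intro infsum_le_finite_sums hs_bound_imp_summable[OF assms]) auto
  then have "sobolev_norm r f \<le> sqrt (X\<^sup>2)" unfolding sobolev_norm_def by (rule real_sqrt_le_mono)
  with X show ?thesis by simp
qed

lemma sobolev_set_integrable:
  assumes "f \<in> sobolev r"
  shows "set_integrable lebesgue {0..2 * pi} f"
proof (rule set_integrable_bound)
  show "set_integrable lebesgue {0..2 * pi} (\<lambda>x. 1 + (cmod (f x))\<^sup>2)"
    using assms
    by (intro set_integral_add(1)) (auto simp: sobolev_def set_integrable_def intro!: integrable_real_indicator)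
  have f: "f \<in> borel_measurable lebesgue" using assms by (simp add: sobolev_def)
  show "set_borel_measurable lebesgue {0..2 * pi} f"
    unfolding set_borel_measurable_def by (intro borel_measurable_scaleR f borel_measurable_indicator) auto
  have "cmod (f x) \<le> 1 + (cmod (f x))\<^sup>2" for x
    using sum_squares_bound[of 1 "cmod (f x)"] by (simp add: power2_eq_square) (smt (verit) norm_ge_zero)
  then show "AE x in lebesgue. x \<in> {0..2 * pi} \<longrightarrow> norm (f x) \<le> norm (1 + (cmod (f x))\<^sup>2)"
    by (intro AE_I2) auto
qed

lemma sobolev_diff:
  assumes f: "f \<in> sobolev r" and g: "g \<in> sobolev r"
  shows "(\<lambda>x. f x - g x) \<in> sobolev r"
    and "fourier_coeff (\<lambda>x. f x - g x) = (\<lambda>k. fourier_coeff f k - fourier_coeff g k)"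
proof -
  show c: "fourier_coeff (\<lambda>x. f x - g x) = (\<lambda>k. fourier_coeff f k - fourier_coeff g k)"
    using fourier_coeff_diff[OF sobolev_set_integrable[OF f] sobolev_set_integrable[OF g]] by auto
  have m: "f \<in> borel_measurable lebesgue" "g \<in> borel_measurable lebesgue"
    using assms by (auto simp: sobolev_def)
  have "set_integrable lebesgue {0..2 * pi} (\<lambda>x. (cmod (f x - g x))\<^sup>2)"
  proof (rule set_integrable_bound)
    show "set_integrable lebesgue {0..2 * pi} (\<lambda>x. 2 * (cmod (f x))\<^sup>2 + 2 * (cmod (g x))\<^sup>2)"
      using assms by (intro set_integral_add(1)) (auto simp: sobolev_def)
    have "(\<lambda>x. f x - g x) \<in> borel_measurable lebesgue" using m by (rule borel_measurable_diff)
    then show "set_borel_measurable lebesgue {0..2 * pi} (\<lambda>x. (cmod (f x - g x))\<^sup>2)"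
      unfolding set_borel_measurable_def
      by (intro borel_measurable_scaleR borel_measurable_indicator borel_measurable_power
          measurable_compose[OF _ borel_measurable_norm]) auto
    have "(cmod (f x - g x))\<^sup>2 \<le> 2 * (cmod (f x))\<^sup>2 + 2 * (cmod (g x))\<^sup>2" for x
    proof -
      have "(cmod (f x - g x))\<^sup>2 \<le> (cmod (f x) + cmod (g x))\<^sup>2"
        by (intro power_mono norm_triangle_ineq4) auto
      also have "\<dots> \<le> 2 * (cmod (f x))\<^sup>2 + 2 * (cmod (g x))\<^sup>2"
        using sum_squares_bound[of "cmod (f x)" "cmod (g x)"] by (simp add: power2_sum)
      finally show ?thesis .
    qed
    then show "AE x in lebesgue. x \<in> {0..2 * pi} \<longrightarrow>
        norm ((cmod (f x - g x))\<^sup>2) \<le> norm (2 * (cmod (f x))\<^sup>2 + 2 * (cmod (g x))\<^sup>2)"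
      by (intro AE_I2) auto
  qed
  moreover have "(\<lambda>x. f x - g x) \<in> borel_measurable lebesgue" using m by (rule borel_measurable_diff)
  ultimately show "(\<lambda>x. f x - g x) \<in> sobolev r"
    using assms hs_bound_imp_summable[OF hs_bound_diff[OF sobolev_hs_bound[OF f] sobolev_hs_bound[OF g]]]
    by (auto simp: sobolev_def c)
qed

lemma trig_series_sobolev:
  assumes r: "r > 1 / 2" and a: "hs_bound r a X"
  shows "trig_series a \<in> sobolev r"
proof -
  note s = hs_bound_abs_summable[OF assms]
  have m: "trig_series a \<in> borel_measurable lebesgue" by (rule trig_series_measurable[OF s])
  have "fourier_coeff (trig_series a) = a"
    using fourier_coeff_trig_series[OF s] by auto
  moreover have "set_integrable lebesgue {0..2 * pi} (\<lambda>x. (cmod (trig_series a x))\<^sup>2)"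
  proof (rule set_integrable_bound)
    let ?K = "\<Sum>\<^sub>\<infinity>k. cmod (a k)"
    show "set_integrable lebesgue {0..2 * pi} (\<lambda>x. ?K\<^sup>2)"
      by (auto simp: set_integrable_def)
    show "set_borel_measurable lebesgue {0..2 * pi} (\<lambda>x. (cmod (trig_series a x))\<^sup>2)"
      unfolding set_borel_measurable_def
      by (intro borel_measurable_scaleR borel_measurable_indicator borel_measurable_power
          measurable_compose[OF m borel_measurable_norm]) auto
    show "AE x in lebesgue. x \<in> {0..2 * pi} \<longrightarrow> norm ((cmod (trig_series a x))\<^sup>2) \<le> norm (?K\<^sup>2)"
      using norm_trig_series_le[OF s] by (intro AE_I2) (auto intro!: power_mono)
  qed
  ultimately show ?thesis
    using m hs_bound_imp_summable[OF a] trig_series_periodic unfolding sobolev_def by auto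
qed

text \<open>
  The difference is integrable and has vanishing Fourier coefficients.
\<close>

lemma sobolev_AE_eq_trig_series:
  assumes r: "r > 1 / 2" and f: "f \<in> sobolev r"
  shows "AE x in lebesgue. x \<in> {0..2 * pi} \<longrightarrow> f x = trig_series (fourier_coeff f) x"
proof -
  let ?g = "trig_series (fourier_coeff f)"
  note b = sobolev_hs_bound[OF f]
  have g: "?g \<in> sobolev r" using r b by (rule trig_series_sobolev)
  have "fourier_null (\<lambda>x. f x - ?g x)"
    unfolding fourier_null_def
    using sobolev_set_integrable[OF sobolev_diff(1)[OF f g]] sobolev_diff(2)[OF f g]
      fourier_coeff_trig_series[OF hs_bound_abs_summable[OF r b]] by simp
  from fourier_null_imp_AE_0[OF this] show ?thesis
    by eventually_elim auto
qed

lemma fourier_coeff_cong_AE: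
  assumes "f \<in> borel_measurable lebesgue" "g \<in> borel_measurable lebesgue"
    and "AE x in lebesgue. x \<in> {0..2 * pi} \<longrightarrow> f x = g x"
  shows "fourier_coeff f k = fourier_coeff g k"
proof -
  have "(\<lambda>x. cis (- (of_int k * x))) \<in> borel_measurable lebesgue"
    by (intro continuous_imp_lebesgue_measurable continuous_intros)
  then have "(LINT x:{0..2 * pi}|lebesgue. f x * cis (- (of_int k * x))) =
      (LINT x:{0..2 * pi}|lebesgue. g x * cis (- (of_int k * x)))"
    using assms by (intro set_lebesgue_integral_cong_AE borel_measurable_times) auto
  then show ?thesis by (simp add: fourier_coeff_def)
qed

lemma fourier_coeff_trig_series_square:
  assumes r: "r > 1 / 2" and a: "hs_bound r a X"
  shows "fourier_coeff (\<lambda>x. (trig_series a x)\<^sup>2) k = conv a a k"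
proof -
  note s = hs_bound_abs_summable[OF assms]
  have "(\<lambda>x. (trig_series a x)\<^sup>2) = trig_series (conv a a)"
    using trig_series_mult[OF s s] by (simp add: power2_eq_square)
  moreover have "hs_bound r (conv a a) (1 * algebra_const r * X * X)"
    by (rule hs_bound_conv[OF r a a]) simp
  ultimately show ?thesis
    using fourier_coeff_trig_series hs_bound_abs_summable[OF r] by simp
qed

lemma fourier_coeff_square:
  assumes r: "r > 1 / 2" and f: "f \<in> sobolev r"
  shows "fourier_coeff (\<lambda>x. (f x)\<^sup>2) k = conv (fourier_coeff f) (fourier_coeff f) k"
proof -
  note b = sobolev_hs_bound[OF f]
  have "f \<in> borel_measurable lebesgue" using f by (simp add: sobolev_def)
  moreover have "trig_series (fourier_coeff f) \<in> borel_measurable lebesgue"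
    by (rule trig_series_measurable[OF hs_bound_abs_summable[OF r b]])
  ultimately have "fourier_coeff (\<lambda>x. (f x)\<^sup>2) k = fourier_coeff (\<lambda>x. (trig_series (fourier_coeff f) x)\<^sup>2) k"
    using sobolev_AE_eq_trig_series[OF r f]
    by (intro fourier_coeff_cong_AE borel_measurable_power) (auto elim!: eventually_mono)
  also have "\<dots> = conv (fourier_coeff f) (fourier_coeff f) k"
    by (rule fourier_coeff_trig_series_square[OF r b])
  finally show ?thesis .
qed

section \<open>The numerical step on Fourier coefficients\<close>

definition free_flow :: "real \<Rightarrow> (int \<Rightarrow> complex) \<Rightarrow> int \<Rightarrow> complex" where
  "free_flow t a k = cis (- (t * (of_int k)\<^sup>2)) * a k"

lemma hs_bound_free_flow: "hs_bound r a X \<Longrightarrow> hs_bound r (free_flow t a) X"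
  using hs_bound_mult[of r a X 1 "free_flow t a"] by (simp add: free_flow_def norm_mult)

lemma schroedinger_flow_eq: "schroedinger_flow t f = trig_series (free_flow t (fourier_coeff f))"
  by (simp add: fun_eq_iff schroedinger_flow_def trig_series_def free_flow_def)

definition inv_deriv_coeff :: "(int \<Rightarrow> complex) \<Rightarrow> int \<Rightarrow> complex" where
  "inv_deriv_coeff a k = inverse (\<i> * of_int k) * a k"

lemma inv_deriv_eq: "inv_deriv f = trig_series (inv_deriv_coeff (fourier_coeff f))"
  unfolding fun_eq_iff inv_deriv_def trig_series_def inv_deriv_coeff_def
  by (intro allI infsum_cong_neutral) auto

lemma hs_bound_inv_deriv_coeff:
  assumes "hs_bound r a X"
  shows "hs_bound r (inv_deriv_coeff a) X"
proof -
  have "cmod (inv_deriv_coeff a k) \<le> 1 * cmod (a k)" for k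
  proof (cases "k = 0")
    case False
    then have "1 \<le> \<bar>real_of_int k\<bar>" by linarith
    then have "inverse \<bar>real_of_int k\<bar> \<le> 1" by (simp add: field_simps)
    then show ?thesis
      unfolding inv_deriv_coeff_def norm_mult norm_inverse
      by (intro mult_right_mono) (auto simp: norm_mult)
  qed (simp add: inv_deriv_coeff_def)
  from hs_bound_mult[OF assms _ this] show ?thesis by simp
qed

text \<open>
  For \<open>n = j l\<close>, the integral over one step of the oscillating phase with which the frequencies
  \<open>j\<close> and \<open>l\<close> interact.
\<close>

definition phase_integral :: "real \<Rightarrow> int \<Rightarrow> complex" where
  "phase_integral \<tau> n = (LINT s:{0..\<tau>}|lebesgue. cis (2 * of_int n * s))"

lemma phase_integral_eq:
  assumes "\<tau> \<ge> 0"
  shows "phase_integral \<tau> n =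
    (if n = 0 then of_real \<tau> else (cis (2 * of_int n * \<tau>) - 1) / (2 * \<i> * of_int n))"
proof (cases "n = 0")
  case True
  then show ?thesis using assms
    by (simp add: phase_integral_def set_lebesgue_integral_def scaleR_conv_of_real)
next
  case False
  then show ?thesis using assms integral_cis[of "2 * of_int n" 0 \<tau>]
    by (simp add: phase_integral_def mult_ac)
qed

lemma norm_phase_integral_le:
  assumes "\<tau> \<ge> 0"
  shows "cmod (phase_integral \<tau> n) \<le> \<tau>"
  using norm_set_integral_le[of "{0..\<tau>}" "\<lambda>s. cis (2 * of_int n * s)" 1] assms
  by (simp add: phase_integral_def)

text \<open>
  The numerical step in exponential-integrator form: the nonlinearity is evaluated along the free
  flow, and its phases are integrated exactly.
\<close>

definition scheme_coeff :: "real \<Rightarrow> real \<Rightarrow> (int \<Rightarrow> complex) \<Rightarrow> int \<Rightarrow> complex" where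
  "scheme_coeff \<mu> \<tau> a k = free_flow \<tau> a k
     - \<i> * of_real \<mu> * free_flow \<tau> (twisted_conv (\<lambda>j l. phase_integral \<tau> (j * l)) a a) k"

text \<open>
  One summand of the exponential integrator. If \<open>j l \<noteq> 0\<close>, the factor \<open>1 / (j l)\<close> from integrating
  the phase splits into the symbols of two inverse derivatives, and \<open>(j + l)\<^sup>2 - 2 j l = j\<^sup>2 +
  l\<^sup>2\<close> lets the free flow act on each factor separately. If \<open>j l = 0\<close>, the phase is constant, and
  one of the two inverse derivatives vanishes.
\<close>

lemma phase_term_split:
  assumes \<tau>: "\<tau> \<ge> 0"
  shows "- (\<i> * of_real \<mu> * cis (- (\<tau> * (of_int (j + l))\<^sup>2)) * (phase_integral \<tau> (j * l) * a j * a l)) =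
    (if j * l = 0 then - (\<i> * of_real \<mu> * of_real \<tau> * cis (- (\<tau> * (of_int (j + l))\<^sup>2)) * a j * a l) else 0)
    + of_real \<mu> / 2 * (free_flow \<tau> (inv_deriv_coeff a) j * free_flow \<tau> (inv_deriv_coeff a) l)
    - of_real \<mu> / 2 * (cis (- (\<tau> * (of_int (j + l))\<^sup>2)) * (inv_deriv_coeff a j * inv_deriv_coeff a l))"
proof (cases "j * l = 0")
  case True
  then have "inv_deriv_coeff a j = 0 \<or> inv_deriv_coeff a l = 0" by (auto simp: inv_deriv_coeff_def)
  with True \<tau> show ?thesis by (auto simp: phase_integral_eq free_flow_def)
next
  case False
  define E where "E = cis (- (\<tau> * (of_int (j + l))\<^sup>2))"
  have E: "E * cis (2 * of_int (j * l) * \<tau>) = cis (- (\<tau> * (of_int j)\<^sup>2)) * cis (- (\<tau> * (of_int l)\<^sup>2))"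
    by (simp add: E_def cis_mult power2_eq_square algebra_simps)
  have jl: "complex_of_int j \<noteq> 0" "complex_of_int l \<noteq> 0" using False by auto
  have "- (\<i> * of_real \<mu> * E * (phase_integral \<tau> (j * l) * a j * a l)) =
      - (of_real \<mu> / 2) * (E * cis (2 * of_int (j * l) * \<tau>) - E) / (of_int j * of_int l) * (a j * a l)"
    using False \<tau> jl by (simp add: phase_integral_eq divide_simps) (simp add: algebra_simps)
  also have "\<dots> = of_real \<mu> / 2 * (free_flow \<tau> (inv_deriv_coeff a) j * free_flow \<tau> (inv_deriv_coeff a) l)
    - of_real \<mu> / 2 * (E * (inv_deriv_coeff a j * inv_deriv_coeff a l))"
    using jl unfolding E free_flow_def inv_deriv_coeff_def by (simp add: field_simps)
  finally show ?thesis using False by (simp add: E_def)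
qed

text \<open>
  Summation of the previous identity over \<open>j + l = k\<close>. The summands with \<open>j l = 0\<close> are those for
  \<open>j = 0\<close> and \<open>j = k\<close>; for \<open>k = 0\<close> they coincide and are counted once, which explains the
  additional constant in the scheme.
\<close>

lemma scheme_coeff_eq:
  assumes r: "r > 1 / 2" and a: "hs_bound r a X" and \<tau>: "\<tau> \<ge> 0"
  defines "d \<equiv> inv_deriv_coeff a"
  shows "scheme_coeff \<mu> \<tau> a k =
    (1 - 2 * \<i> * of_real \<mu> * of_real \<tau> * a 0) * free_flow \<tau> a k
     + (if k = 0 then \<i> * of_real \<mu> * of_real \<tau> * (a 0)\<^sup>2 else 0)
     + of_real \<mu> / 2 * conv (free_flow \<tau> d) (free_flow \<tau> d) k
     - of_real \<mu> / 2 * free_flow \<tau> (conv d d) k"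
proof -
  let ?E = "cis (- (\<tau> * (of_int k)\<^sup>2))"
  have d: "hs_bound r d X" unfolding d_def by (rule hs_bound_inv_deriv_coeff[OF a])
  note Ed = hs_bound_free_flow[OF d, of \<tau>]
  have S: "((\<lambda>j. m j (k - j) * f j * g (k - j)) has_sum twisted_conv m f g k) UNIV"
    if "hs_bound r f Y" "hs_bound r g Z" "\<And>j l. cmod (m j l) \<le> c" for m f g Y Z c
    unfolding twisted_conv_def
    by (rule has_sum_infsum, rule abs_summable_summable, rule conv_terms_summable[OF _ that]) (use r in auto)
  define c where "c j = (if j * (k - j) = 0 then - (\<i> * of_real \<mu> * of_real \<tau> * ?E * a j * a (k - j)) else 0)" for j
  define C where "C = - (2 * \<i> * of_real \<mu> * of_real \<tau> * a 0) * free_flow \<tau> a k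
     + (if k = 0 then \<i> * of_real \<mu> * of_real \<tau> * (a 0)\<^sup>2 else 0)"
  have "(c has_sum C) UNIV"
  proof (rule has_sum_finite_neutralI[of "{0, k}"])
    show "C = (\<Sum>j\<in>{0, k}. c j)"
      by (cases "k = 0") (auto simp: C_def c_def free_flow_def power2_eq_square algebra_simps)
  qed (auto simp: c_def)
  moreover have "((\<lambda>j. of_real \<mu> / 2 * (1 * free_flow \<tau> d j * free_flow \<tau> d (k - j))) has_sum
      of_real \<mu> / 2 * conv (free_flow \<tau> d) (free_flow \<tau> d) k) UNIV"
    by (rule has_sum_cmult_right[OF S[OF Ed Ed, of "\<lambda>_ _. 1" 1]]) simp
  moreover have "((\<lambda>j. - (of_real \<mu> / 2 * ?E) * (1 * d j * d (k - j))) has_sum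
      - (of_real \<mu> / 2 * ?E) * conv d d k) UNIV"
    by (rule has_sum_cmult_right[OF S[OF d d, of "\<lambda>_ _. 1" 1]]) simp
  ultimately have 1: "((\<lambda>j. c j + of_real \<mu> / 2 * (1 * free_flow \<tau> d j * free_flow \<tau> d (k - j))
        + - (of_real \<mu> / 2 * ?E) * (1 * d j * d (k - j))) has_sum
      C + of_real \<mu> / 2 * conv (free_flow \<tau> d) (free_flow \<tau> d) k + - (of_real \<mu> / 2 * ?E) * conv d d k) UNIV"
    by (intro has_sum_add)
  have 2: "((\<lambda>j. - (\<i> * of_real \<mu> * ?E) * (phase_integral \<tau> (j * (k - j)) * a j * a (k - j))) has_sum
      - (\<i> * of_real \<mu> * ?E) * twisted_conv (\<lambda>j l. phase_integral \<tau> (j * l)) a a k) UNIV"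
    by (rule has_sum_cmult_right[OF S[OF a a norm_phase_integral_le[OF \<tau>]]])
  have eq: "- (\<i> * of_real \<mu> * ?E) * (phase_integral \<tau> (j * (k - j)) * a j * a (k - j)) =
      c j + of_real \<mu> / 2 * (1 * free_flow \<tau> d j * free_flow \<tau> d (k - j))
        + - (of_real \<mu> / 2 * ?E) * (1 * d j * d (k - j))" for j
    using phase_term_split[OF \<tau>, of \<mu> j "k - j" a]
    unfolding c_def d_def by (simp add: mult.assoc)
  from 1 2 have "- (\<i> * of_real \<mu> * ?E) * twisted_conv (\<lambda>j l. phase_integral \<tau> (j * l)) a a k =
     C + of_real \<mu> / 2 * conv (free_flow \<tau> d) (free_flow \<tau> d) k + - (of_real \<mu> / 2 * ?E) * conv d d k"
    unfolding eq by (rule has_sum_unique[rotated])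
  then show ?thesis
    by (simp add: scheme_coeff_def C_def free_flow_def[of \<tau> "twisted_conv _ _ _"] algebra_simps)
qed

lemma scheme_step_eq_trig_series:
  assumes r: "r > 1 / 2" and v: "hs_bound r (fourier_coeff v) X" and \<tau>: "\<tau> \<ge> 0"
  shows "scheme_step \<mu> \<tau> v = trig_series (scheme_coeff \<mu> \<tau> (fourier_coeff v))"
proof
  fix x
  define a where "a = fourier_coeff v"
  define d where "d = inv_deriv_coeff a"
  have a: "hs_bound r a X" using v by (simp add: a_def)
  have d: "hs_bound r d X" unfolding d_def by (rule hs_bound_inv_deriv_coeff[OF a])
  note Ed = hs_bound_free_flow[OF d, of \<tau>]
  have S: "((\<lambda>k. b k * cis (of_int k * x)) has_sum trig_series b x) UNIV" if "hs_bound r b Y" for b Y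
    by (rule trig_series_has_sum[OF hs_bound_abs_summable[OF r that]])
  have cc: "hs_bound r (conv f f) (1 * algebra_const r * X * X)" if "hs_bound r f X" for f
    by (rule hs_bound_conv[OF r that that]) simp
  have coeff_d: "fourier_coeff (trig_series d) = d"
    using fourier_coeff_trig_series[OF hs_bound_abs_summable[OF r d]] by auto
  have sq: "(trig_series (free_flow \<tau> d) x)\<^sup>2 = trig_series (conv (free_flow \<tau> d) (free_flow \<tau> d)) x"
    using trig_series_mult[OF hs_bound_abs_summable[OF r Ed] hs_bound_abs_summable[OF r Ed]]
    by (simp add: power2_eq_square)
  have "fourier_coeff (\<lambda>y. (trig_series d y)\<^sup>2) = conv d d"
    using fourier_coeff_trig_series_square[OF r d] by auto
  then have step: "scheme_step \<mu> \<tau> v x =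
     (1 - 2 * \<i> * of_real \<mu> * of_real \<tau> * a 0) * trig_series (free_flow \<tau> a) x
     + \<i> * of_real \<mu> * of_real \<tau> * (a 0)\<^sup>2
     + of_real \<mu> / 2 * trig_series (conv (free_flow \<tau> d) (free_flow \<tau> d)) x
     - of_real \<mu> / 2 * trig_series (free_flow \<tau> (conv d d)) x"
    unfolding scheme_step_def schroedinger_flow_eq inv_deriv_eq
    by (simp add: coeff_d sq flip: a_def d_def)
  have "((\<lambda>k. (1 - 2 * \<i> * of_real \<mu> * of_real \<tau> * a 0) * (free_flow \<tau> a k * cis (of_int k * x))
     + (if k = 0 then \<i> * of_real \<mu> * of_real \<tau> * (a 0)\<^sup>2 else 0)
     + of_real \<mu> / 2 * (conv (free_flow \<tau> d) (free_flow \<tau> d) k * cis (of_int k * x))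
     + - (of_real \<mu> / 2) * (free_flow \<tau> (conv d d) k * cis (of_int k * x))) has_sum
     (1 - 2 * \<i> * of_real \<mu> * of_real \<tau> * a 0) * trig_series (free_flow \<tau> a) x
     + \<i> * of_real \<mu> * of_real \<tau> * (a 0)\<^sup>2
     + of_real \<mu> / 2 * trig_series (conv (free_flow \<tau> d) (free_flow \<tau> d)) x
     + - (of_real \<mu> / 2) * trig_series (free_flow \<tau> (conv d d)) x) UNIV"
    by (intro has_sum_add has_sum_cmult_right S[OF hs_bound_free_flow[OF a]] S[OF cc[OF Ed]]
        S[OF hs_bound_free_flow[OF cc[OF d]]] has_sum_finite_neutralI[of "{0}"]) auto
  also have "(\<lambda>k. (1 - 2 * \<i> * of_real \<mu> * of_real \<tau> * a 0) * (free_flow \<tau> a k * cis (of_int k * x))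
     + (if k = 0 then \<i> * of_real \<mu> * of_real \<tau> * (a 0)\<^sup>2 else 0)
     + of_real \<mu> / 2 * (conv (free_flow \<tau> d) (free_flow \<tau> d) k * cis (of_int k * x))
     + - (of_real \<mu> / 2) * (free_flow \<tau> (conv d d) k * cis (of_int k * x))) =
     (\<lambda>k. scheme_coeff \<mu> \<tau> a k * cis (of_int k * x))"
    unfolding scheme_coeff_eq[OF r a \<tau>] d_def by (auto simp: algebra_simps)
  finally show "scheme_step \<mu> \<tau> v x = trig_series (scheme_coeff \<mu> \<tau> (fourier_coeff v)) x"
    unfolding step a_def[symmetric] by (simp add: trig_series_def has_sum_iff)
qed

section \<open>Duhamel's formula on Fourier coefficients\<close>

lemma root_of_unity_average:
  assumes "N > 0" "\<bar>n\<bar> < int N"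
  shows "(\<Sum>l<N. cis (of_int n * (2 * pi * real l / real N))) / of_nat N = (if n = 0 then 1 else 0)"
proof (cases "n = 0")
  case False
  define z where "z = cis (of_int n * (2 * pi / real N))"
  have z: "cis (of_int n * (2 * pi * real l / real N)) = z ^ l" for l
  proof -
    have "of_int n * (2 * pi * real l / real N) = real l * (of_int n * (2 * pi / real N))" by simp
    then show ?thesis by (simp only: z_def Complex.DeMoivre)
  qed
  have "z ^ N = cis (2 * pi * of_int n)"
    unfolding z_def Complex.DeMoivre using assms(1) by (simp add: mult_ac)
  then have zN: "z ^ N = 1" by simp
  have "z \<noteq> 1"
  proof
    assume "z = 1"
    then have "cos (of_int n * (2 * pi / real N)) = 1" by (simp add: z_def complex_eq_iff)
    then obtain m :: int where "of_int n * (2 * pi / real N) = of_int m * 2 * pi"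
      using cos_one_2pi_int by blast
    then have "real_of_int n = real_of_int m * real N"
      using assms(1) by (simp add: field_simps)
    then have n: "n = m * int N" by (metis of_int_eq_iff of_int_mult of_int_of_nat_eq)
    with assms(2) have "\<bar>m\<bar> * int N < 1 * int N" by (simp add: abs_mult)
    then have "\<bar>m\<bar> < 1" by (rule mult_right_less_imp_less) simp
    with n False show False by simp
  qed
  then have "(\<Sum>l<N. z ^ l) = 0" using zN by (simp add: geometric_sum)
  then show ?thesis unfolding z using False by simp
qed (use assms in simp)

lemma has_sum_finite_sum:
  fixes f :: "'l \<Rightarrow> 'i \<Rightarrow> complex"
  assumes "\<And>l. l \<in> L \<Longrightarrow> (f l has_sum s l) A"
  shows "((\<lambda>j. \<Sum>l\<in>L. f l j) has_sum (\<Sum>l\<in>L. s l)) A"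
  using assms by (induction L rule: infinite_finite_induct) (auto intro!: has_sum_add)

text \<open>
  Discrete Fourier coefficients from \<open>N\<close> equidistant samples: the aliased frequencies, those
  different from but congruent to \<open>k\<close> modulo \<open>N\<close>, move out to infinity as \<open>N\<close> grows. The averages
  involve finitely many point values only, and thus measurability of point values in a parameter
  passes to the coefficients.
\<close>

lemma trig_series_sample_average:
  assumes a: "(\<lambda>k. cmod (a k)) summable_on UNIV"
  defines "x \<equiv> \<lambda>N l. 2 * pi * real l / real (Suc N)"
  shows "(\<lambda>N. (\<Sum>l<Suc N. trig_series a (x N l) * cis (- (of_int k * x N l))) / of_nat (Suc N))
    \<longlonglongrightarrow> a k"
proof (rule metric_LIMSEQ_I)
  fix e :: real assume e: "e > 0"
  define A where "A = (\<Sum>\<^sub>\<infinity>j. cmod (a j))"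
  have A: "((\<lambda>j. cmod (a j)) has_sum A) UNIV" using a by (simp add: A_def)
  then have "\<forall>\<^sub>F F in finite_subsets_at_top UNIV. dist (\<Sum>j\<in>F. cmod (a j)) A < e"
    using e by (auto simp: has_sum_def dest: tendstoD)
  then obtain F0 where F0: "finite F0"
    and F0': "\<And>F. finite F \<Longrightarrow> F0 \<subseteq> F \<Longrightarrow> dist (\<Sum>j\<in>F. cmod (a j)) A < e"
    by (auto simp: eventually_finite_subsets_at_top)
  \<comment> \<open>Outside \<open>F\<close> the series is small, and once \<open>N\<close> exceeds all distances from \<open>F\<close> to \<open>k\<close>, the only frequency
    of \<open>F\<close> that contributes to the average is \<open>k\<close> itself.\<close>
  define F where "F = insert k F0"
  have F: "finite F" "k \<in> F"
    using F0 by (auto simp: F_def)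
  have "dist (\<Sum>j\<in>F. cmod (a j)) A < e"
    using F by (intro F0') (auto simp: F_def)
  then have tail: "A - (\<Sum>j\<in>F. cmod (a j)) < e"
    by (simp add: dist_real_def)
  define N0 where "N0 = nat (\<Sum>j\<in>F. \<bar>j - k\<bar>)"
  have N0: "\<bar>j - k\<bar> < int (Suc N)" if "j \<in> F" "N \<ge> N0" for j N
    using member_le_sum[of j F "\<lambda>j. \<bar>j - k\<bar>"] F that by (auto simp: N0_def)
  have "dist ((\<Sum>l<Suc N. trig_series a (x N l) * cis (- (of_int k * x N l))) / of_nat (Suc N)) (a k) < e"
    if N: "N \<ge> N0" for N
  proof -
    define v where "v = (\<Sum>l<Suc N. trig_series a (x N l) * cis (- (of_int k * x N l))) / of_nat (Suc N)"
    define w where "w n = (\<Sum>l<Suc N. cis (of_int n * x N l)) / of_nat (Suc N)" for n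
    have w: "w n = (if n = 0 then 1 else 0)" if "\<bar>n\<bar> < int (Suc N)" for n
      using root_of_unity_average[of "Suc N" n] that by (simp add: w_def x_def)
    have w1: "cmod (w n) \<le> 1" for n
    proof -
      have "cmod (\<Sum>l<Suc N. cis (of_int n * x N l)) \<le> real (Suc N)"
        using norm_sum[of "\<lambda>l. cis (of_int n * x N l)" "{..<Suc N}"] by simp
      then show ?thesis by (simp add: w_def norm_divide del: of_nat_Suc)
    qed
    have "((\<lambda>j. \<Sum>l<Suc N. a j * cis (of_int j * x N l) * cis (- (of_int k * x N l))) has_sum
        (\<Sum>l<Suc N. trig_series a (x N l) * cis (- (of_int k * x N l)))) UNIV"
      by (intro has_sum_finite_sum has_sum_cmult_left trig_series_has_sum a)
    from has_sum_cmult_left[OF this, of "1 / of_nat (Suc N)"]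
    have "((\<lambda>j. (\<Sum>l<Suc N. a j * cis (of_int j * x N l) * cis (- (of_int k * x N l))) / of_nat (Suc N)) has_sum v) UNIV"
      by (simp add: v_def del: of_nat_Suc)
    moreover have "(\<Sum>l<Suc N. a j * cis (of_int j * x N l) * cis (- (of_int k * x N l))) / of_nat (Suc N)
        = a j * w (j - k)" for j
    proof -
      have "a j * cis (of_int j * x N l) * cis (- (of_int k * x N l)) = a j * cis (of_int (j - k) * x N l)" for l
        by (simp add: mult.assoc cis_mult left_diff_distrib)
      then show ?thesis unfolding w_def by (simp only: sum_distrib_left times_divide_eq_right)
    qed
    ultimately have "((\<lambda>j. a j * w (j - k)) has_sum v) UNIV" by simp
    moreover have "((\<lambda>j. if j = k then - a k else 0) has_sum - a k) UNIV"
      by (rule has_sum_finite_neutralI[of "{k}"]) auto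
    ultimately have 1: "((\<lambda>j. a j * w (j - k) + (if j = k then - a k else 0)) has_sum v + - a k) UNIV"
      by (rule has_sum_add)
    have "((\<lambda>j. if j \<in> F then - cmod (a j) else 0) has_sum - (\<Sum>j\<in>F. cmod (a j))) UNIV"
      using F by (intro has_sum_finite_neutralI[of F]) (auto simp: sum_negf)
    from has_sum_add[OF A this]
    have 2: "((\<lambda>j. cmod (a j) + (if j \<in> F then - cmod (a j) else 0)) has_sum A - (\<Sum>j\<in>F. cmod (a j))) UNIV"
      by simp
    have "norm (v + - a k) \<le> A - (\<Sum>j\<in>F. cmod (a j))"
    proof (rule norm_infsum_le[OF 1 2])
      fix j
      show "norm (a j * w (j - k) + (if j = k then - a k else 0)) \<le> cmod (a j) + (if j \<in> F then - cmod (a j) else 0)"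
      proof (cases "j \<in> F")
        case True
        then show ?thesis using w[OF N0[OF True N]] by auto
      next
        case False
        then have "j \<noteq> k" using F by auto
        with False show ?thesis using w1[of "j - k"] by (simp add: norm_mult mult_left_le)
      qed
    qed
    with tail show ?thesis by (simp add: dist_norm v_def)
  qed
  then show "\<exists>N0. \<forall>N\<ge>N0. dist ((\<Sum>l<Suc N. trig_series a (x N l) * cis (- (of_int k * x N l))) / of_nat (Suc N)) (a k) < e"
    by blast
qed

text \<open>
  Duhamel's formula for each Fourier coefficient. Measurability in time is given at every fixed
  point \<open>x\<close> and reaches the coefficients through sample averages. The integral of the Fourier
  series is then taken termwise; the termwise integrals again form an \<open>H\<^sup>r\<close> sequence by
  Minkowski's inequality.
\<close>

lemma mild_solution_coeff:
  fixes u :: "real \<Rightarrow> real \<Rightarrow> complex"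
  defines "a \<equiv> \<lambda>t. fourier_coeff (u t)"
  assumes r: "r > 1 / 2" and T: "T \<ge> 0" and mild: "mild_solution \<mu> T u"
    and sob: "\<And>t. t \<in> {0..T} \<Longrightarrow> u t \<in> sobolev r"
    and bound: "\<And>t. t \<in> {0..T} \<Longrightarrow> hs_bound r (a t) M"
  shows "set_borel_measurable lebesgue {0..T} (\<lambda>s. conv (a s) (a s) k)"
    and "t \<in> {0..T} \<Longrightarrow> a t k = free_flow t (a 0) k
      - \<i> * of_real \<mu> * (LINT s:{0..t}|lebesgue. free_flow (t - s) (conv (a s) (a s)) k)"
proof -
  define W where "W s = conv (a s) (a s)" for s
  define B where "B = 1 * algebra_const r * M * M"
  have W: "hs_bound r (W s) B" if "s \<in> {0..T}" for s
    unfolding W_def B_def by (rule hs_bound_conv[OF r bound[OF that] bound[OF that]]) simp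
  have flow: "schroedinger_flow c (\<lambda>y. (u s y)\<^sup>2) = trig_series (free_flow c (W s))" if "s \<in> {0..T}" for c s
  proof -
    have "fourier_coeff (\<lambda>y. (u s y)\<^sup>2) = W s"
      unfolding W_def a_def using fourier_coeff_square[OF r sob[OF that]] by auto
    then show ?thesis by (simp add: schroedinger_flow_eq)
  qed
  have meas: "set_borel_measurable lebesgue {0..t} (\<lambda>s. free_flow (t - s) (W s) k)"
    if t: "t \<in> {0..T}" for t k
  proof -
    have m: "(\<lambda>s. indicator {0..t} s *\<^sub>R trig_series (free_flow (t - s) (W s)) x) \<in> borel_measurable lebesgue" for x
    proof -
      have "set_integrable lebesgue {0..t} (\<lambda>s. schroedinger_flow (t - s) (\<lambda>y. (u s y)\<^sup>2) x)"
        using mild t by (auto simp: mild_solution_def)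
      then have "(\<lambda>s. indicator {0..t} s *\<^sub>R schroedinger_flow (t - s) (\<lambda>y. (u s y)\<^sup>2) x) \<in> borel_measurable lebesgue"
        unfolding set_integrable_def by (rule borel_measurable_integrable)
      also have "(\<lambda>s. indicator {0..t} s *\<^sub>R schroedinger_flow (t - s) (\<lambda>y. (u s y)\<^sup>2) x) =
          (\<lambda>s. indicator {0..t} s *\<^sub>R trig_series (free_flow (t - s) (W s)) x)"
      proof
        fix s show "indicator {0..t} s *\<^sub>R schroedinger_flow (t - s) (\<lambda>y. (u s y)\<^sup>2) x =
            indicator {0..t} s *\<^sub>R trig_series (free_flow (t - s) (W s)) x"
          using t flow[of s] by (cases "s \<in> {0..t}") auto
      qed
      finally show ?thesis .
    qed
    let ?x = "\<lambda>N l. 2 * pi * real l / real (Suc N)"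
    show ?thesis
      unfolding set_borel_measurable_def
    proof (rule borel_measurable_LIMSEQ_metric)
      show "(\<lambda>s. (\<Sum>l<Suc N. (indicator {0..t} s *\<^sub>R trig_series (free_flow (t - s) (W s)) (?x N l)) *
          cis (- (of_int k * ?x N l))) / of_nat (Suc N)) \<in> borel_measurable lebesgue" for N
        by (intro borel_measurable_divide borel_measurable_sum borel_measurable_times m borel_measurable_const)
      show "(\<lambda>N. (\<Sum>l<Suc N. (indicator {0..t} s *\<^sub>R trig_series (free_flow (t - s) (W s)) (?x N l)) *
          cis (- (of_int k * ?x N l))) / of_nat (Suc N))
          \<longlonglongrightarrow> indicator {0..t} s *\<^sub>R free_flow (t - s) (W s) k" for s
      proof (cases "s \<in> {0..t}")
        case True
        then have "s \<in> {0..T}" using t by auto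
        from trig_series_sample_average[OF hs_bound_abs_summable[OF r hs_bound_free_flow[OF W[OF this], of "t - s"]], of k]
        show ?thesis using True by simp
      qed simp
    qed
  qed
  \<comment> \<open>Undo the free flow in the case of the final time \<open>T\<close>.\<close>
  have "set_borel_measurable lebesgue {0..T} (\<lambda>s. cis ((T - s) * (of_int k)\<^sup>2) * free_flow (T - s) (W s) k)"
    using T by (intro set_borel_measurable_mult_continuous meas continuous_intros) auto
  moreover have "cis ((T - s) * (of_int k)\<^sup>2) * free_flow (T - s) (W s) k = W s k" for s
    by (simp add: free_flow_def cis_mult flip: mult.assoc)
  ultimately show "set_borel_measurable lebesgue {0..T} (\<lambda>s. conv (a s) (a s) k)"
    by (simp add: W_def)
  assume t: "t \<in> {0..T}"
  define V where "V k = (LINT s:{0..t}|lebesgue. free_flow (t - s) (W s) k)" for k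
  define c where "c k = free_flow t (a 0) k - (\<i> * of_real \<mu>) * V k" for k
  have Wt: "hs_bound r (free_flow (t - s) (W s)) B" if "s \<in> {0..t}" for s
    using W that t by (intro hs_bound_free_flow) auto
  have V: "hs_bound r V (measure lebesgue {0..t} * B)"
    unfolding V_def using meas[OF t] Wt by (intro hs_bound_set_integral) auto
  have V': "hs_bound r (\<lambda>k. (\<i> * of_real \<mu>) * V k) (\<bar>\<mu>\<bar> * (measure lebesgue {0..t} * B))"
    by (rule hs_bound_mult[OF V]) (auto simp: norm_mult)
  have a0: "hs_bound r (free_flow t (a 0)) M"
    using bound T by (intro hs_bound_free_flow) auto
  note cb = hs_bound_diff[OF a0 V', folded c_def]
  have duh: "(LINT s:{0..t}|lebesgue. schroedinger_flow (t - s) (\<lambda>y. (u s y)\<^sup>2) x) = trig_series V x" for x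
  proof -
    have "(LINT s:{0..t}|lebesgue. schroedinger_flow (t - s) (\<lambda>y. (u s y)\<^sup>2) x) =
        (LINT s:{0..t}|lebesgue. (\<Sum>\<^sub>\<infinity>k. cis (of_int k * x) * free_flow (t - s) (W s) k))"
      using flow t by (intro set_lebesgue_integral_cong) (auto simp: trig_series_def mult.commute)
    also have "\<dots> = (\<Sum>\<^sub>\<infinity>k. LINT s:{0..t}|lebesgue. cis (of_int k * x) * free_flow (t - s) (W s) k)"
    proof (rule set_integral_infsum)
      show "set_borel_measurable lebesgue {0..t} (\<lambda>s. cis (of_int k * x) * free_flow (t - s) (W s) k)" for k
        by (rule set_borel_measurable_cmult[OF meas[OF t]])
      show "(\<Sum>k\<in>F. cmod (cis (of_int k * x) * free_flow (t - s) (W s) k)) \<le> sqrt (inv_weight_sum r) * B"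
        if "s \<in> {0..t}" "finite F" for s F
        using hs_bound_l1[OF r Wt[OF that(1)] that(2)] by (simp add: norm_mult)
      show "(\<lambda>k. LINT s:{0..t}|lebesgue. cis (of_int k * x) * free_flow (t - s) (W s) k) summable_on UNIV"
        using trig_series_has_sum[OF hs_bound_abs_summable[OF r V], of x]
        by (auto simp: V_def mult.commute has_sum_iff)
    qed auto
    also have "\<dots> = trig_series V x"
      by (simp add: trig_series_def V_def mult.commute)
    finally show ?thesis .
  qed
  have "trig_series c x = trig_series (free_flow t (a 0)) x - \<i> * of_real \<mu> * trig_series V x" for x
  proof -
    have "((\<lambda>k. free_flow t (a 0) k * cis (of_int k * x) + - (\<i> * of_real \<mu>) * (V k * cis (of_int k * x))) has_sum
        trig_series (free_flow t (a 0)) x + - (\<i> * of_real \<mu>) * trig_series V x) UNIV"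
      by (intro has_sum_add has_sum_cmult_right trig_series_has_sum
          hs_bound_abs_summable[OF r a0] hs_bound_abs_summable[OF r V])
    then show ?thesis
      unfolding trig_series_def[of c] by (simp add: c_def algebra_simps has_sum_iff)
  qed
  moreover have "AE x in lebesgue. u t x = schroedinger_flow t (u 0) x
      - \<i> * of_real \<mu> * (LINT s:{0..t}|lebesgue. schroedinger_flow (t - s) (\<lambda>y. (u s y)\<^sup>2) x)"
    using mild t unfolding mild_solution_def by blast
  ultimately have "AE x in lebesgue. u t x = trig_series c x"
    unfolding duh by (simp add: schroedinger_flow_eq a_def)
  then have "fourier_coeff (u t) k = fourier_coeff (trig_series c) k"
    using sob[OF t] trig_series_measurable[OF hs_bound_abs_summable[OF r cb]]
    by (intro fourier_coeff_cong_AE) (auto simp: sobolev_def elim!: eventually_mono)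
  then have "a t k = c k"
    using fourier_coeff_trig_series[OF hs_bound_abs_summable[OF r cb]] by (simp add: a_def)
  then show "a t k = free_flow t (a 0) k
      - \<i> * of_real \<mu> * (LINT s:{0..t}|lebesgue. free_flow (t - s) (conv (a s) (a s)) k)"
    by (simp add: c_def V_def W_def)
qed

section \<open>Local error, stability and convergence\<close>

lemma set_integral_half_open: "(LINT s:{a<..b}|lebesgue. f s) = (LINT s:{a..b}|lebesgue. f s)"
  for f :: "real \<Rightarrow> complex"
  by (rule set_integral_discrete_difference[of "{a}"]) auto

text \<open>
  The step of the scheme is Duhamel's integral along the free flow: since \<open>(j + l)\<^sup>2 - j\<^sup>2 - l\<^sup>2 =
  2 j l\<close>, the pair \<open>j\<close>, \<open>l\<close> contributes with the phase \<open>2 j l (s - t)\<close>. The starting time \<open>t\<close> is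
  arbitrary because only \<open>s - t\<close> enters.
\<close>

lemma integral_free_flow_conv:
  assumes r: "r > 1 / 2" and b: "hs_bound r b X" and \<tau>: "\<tau> \<ge> 0"
  shows "set_integrable lebesgue {t..t + \<tau>}
      (\<lambda>s. free_flow (t + \<tau> - s) (conv (free_flow (s - t) b) (free_flow (s - t) b)) k)"
    and "(LINT s:{t..t + \<tau>}|lebesgue. free_flow (t + \<tau> - s) (conv (free_flow (s - t) b) (free_flow (s - t) b)) k) =
    free_flow \<tau> (twisted_conv (\<lambda>j l. phase_integral \<tau> (j * l)) b b) k"
proof -
  let ?I = "{t..t + \<tau>}"
  let ?E = "cis (- (\<tau> * (of_int k)\<^sup>2))"
  define f where "f j s = (?E * b j * b (k - j)) * cis (2 * of_int (j * (k - j)) * (s - t))" for j s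
  have X: "X \<ge> 0" using b by (rule hs_bound_nonneg)
  have phase: "(LINT s:?I|lebesgue. cis (2 * of_int n * (s - t))) = phase_integral \<tau> n" for n
  proof (cases "n = 0")
    case True
    then show ?thesis using \<tau>
      by (simp add: phase_integral_eq set_lebesgue_integral_def scaleR_conv_of_real)
  next
    case False
    have "(LINT s:?I|lebesgue. cis (2 * of_int n * (s - t))) =
        (LINT s:?I|lebesgue. cis (- (2 * of_int n * t)) * cis (2 * of_int n * s))"
      by (simp add: cis_mult algebra_simps)
    also have "\<dots> = cis (- (2 * of_int n * t)) *
        ((cis (2 * of_int n * (t + \<tau>)) - cis (2 * of_int n * t)) / (\<i> * of_real (2 * of_int n)))"
      using integral_cis[of "2 * of_int n" t "t + \<tau>"] False \<tau> by simp
    also have "\<dots> = (cis (2 * of_int n * \<tau>) - 1) / (2 * \<i> * of_int n)"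
      by (simp add: right_diff_distrib cis_mult distrib_left mult_ac)
    finally show ?thesis using False \<tau> by (simp add: phase_integral_eq)
  qed
  have int_f: "(LINT s:?I|lebesgue. f j s) = ?E * (phase_integral \<tau> (j * (k - j)) * b j * b (k - j))" for j
    unfolding f_def set_integral_mult_right phase by (simp add: mult_ac)
  have summ: "(\<lambda>j. phase_integral \<tau> (j * (k - j)) * b j * b (k - j)) summable_on UNIV"
    by (rule abs_summable_summable, rule conv_terms_summable[OF _ b b norm_phase_integral_le[OF \<tau>]])
      (use r in auto)
  have expand: "free_flow (t + \<tau> - s) (conv (free_flow (s - t) b) (free_flow (s - t) b)) k = (\<Sum>\<^sub>\<infinity>j. f j s)" for s
  proof -
    have "cis (- ((t + \<tau> - s) * (of_int k)\<^sup>2)) *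
        (1 * free_flow (s - t) b j * free_flow (s - t) b (k - j)) = f j s" for j
    proof -
      have "cis (- ((t + \<tau> - s) * (of_int k)\<^sup>2)) * cis (- ((s - t) * (of_int j)\<^sup>2)) *
          cis (- ((s - t) * (of_int (k - j))\<^sup>2)) = ?E * cis (2 * of_int (j * (k - j)) * (s - t))"
        by (simp add: cis_mult power2_eq_square algebra_simps)
      then have "cis (- ((t + \<tau> - s) * (of_int k)\<^sup>2)) * cis (- ((s - t) * (of_int j)\<^sup>2)) *
          cis (- ((s - t) * (of_int (k - j))\<^sup>2)) * (b j * b (k - j)) = ?E * cis (2 * of_int (j * (k - j)) * (s - t)) * (b j * b (k - j))"
        by simp
      then show ?thesis by (simp add: f_def free_flow_def mult_ac)
    qed
    then show ?thesis
      by (simp add: free_flow_def[of _ "twisted_conv _ _ _"] twisted_conv_def flip: infsum_cmult_right')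
  qed
  have f_meas: "set_borel_measurable lebesgue ?I (f j)" for j
    unfolding f_def by (intro set_borel_measurable_continuous continuous_intros) auto
  have f_le: "(\<Sum>j\<in>F. cmod (f j s)) \<le> 1 * (X * X)" if "finite F" for F s
    using sum_conv_terms_le[OF _ b b that, of "\<lambda>_ _. 1" 1 k] r
    by (simp add: f_def norm_mult)
  have f_summable: "(\<lambda>j. norm (f j s)) summable_on UNIV" for s
    by (rule nonneg_bdd_above_summable_on) (use f_le in \<open>auto simp: bdd_above_def\<close>)
  show "set_integrable lebesgue ?I
      (\<lambda>s. free_flow (t + \<tau> - s) (conv (free_flow (s - t) b) (free_flow (s - t) b)) k)"
    unfolding expand
  proof (rule set_integrable_bounded)
    show "set_borel_measurable lebesgue ?I (\<lambda>s. \<Sum>\<^sub>\<infinity>j. f j s)"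
      using f_meas abs_summable_summable[OF f_summable] by (rule set_borel_measurable_infsum)
    show "cmod (\<Sum>\<^sub>\<infinity>j. f j s) \<le> 1 * (X * X)" for s
      using norm_infsum_bound[OF f_summable] infsum_le_finite_sums[OF f_summable f_le]
      by (rule order_trans)
  qed auto
  have "(LINT s:?I|lebesgue. (\<Sum>\<^sub>\<infinity>j. f j s)) = (\<Sum>\<^sub>\<infinity>j. LINT s:?I|lebesgue. f j s)"
  proof (rule set_integral_infsum)
    show "(\<lambda>j. LINT s:?I|lebesgue. f j s) summable_on UNIV"
      unfolding int_f using summ by (rule summable_on_cmult_right)
  qed (use f_meas f_le in auto)
  also have "\<dots> = free_flow \<tau> (twisted_conv (\<lambda>j l. phase_integral \<tau> (j * l)) b b) k"
    unfolding int_f free_flow_def[of _ "twisted_conv _ _ _"] twisted_conv_def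
    by (rule infsum_cmult_right[OF summ])
  finally show "(LINT s:?I|lebesgue. free_flow (t + \<tau> - s) (conv (free_flow (s - t) b) (free_flow (s - t) b)) k) =
      free_flow \<tau> (twisted_conv (\<lambda>j l. phase_integral \<tau> (j * l)) b b) k"
    by (simp add: expand)
qed

text \<open>
  Time translation of Duhamel's formula by the group property of the free flow.
\<close>

lemma duhamel_from_intermediate_time:
  fixes a :: "real \<Rightarrow> int \<Rightarrow> complex"
  assumes r: "r > 1 / 2"
    and bound: "\<And>t. t \<in> {0..T} \<Longrightarrow> hs_bound r (a t) M"
    and meas: "\<And>k. set_borel_measurable lebesgue {0..T} (\<lambda>s. conv (a s) (a s) k)"
    and duhamel: "\<And>t k. t \<in> {0..T} \<Longrightarrow> a t k = free_flow t (a 0) k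
      - \<i> * of_real \<mu> * (LINT s:{0..t}|lebesgue. free_flow (t - s) (conv (a s) (a s)) k)"
    and t: "0 \<le> t" "t \<le> t'" "t' \<le> T"
  shows "set_integrable lebesgue {t..t'} (\<lambda>s. free_flow (t' - s) (conv (a s) (a s)) k)"
    and "a t' k = free_flow (t' - t) (a t) k
      - \<i> * of_real \<mu> * (LINT s:{t..t'}|lebesgue. free_flow (t' - s) (conv (a s) (a s)) k)"
proof -
  define W where "W s = conv (a s) (a s)" for s
  have W: "hs_bound r (W s) (1 * algebra_const r * M * M)" if "s \<in> {0..T}" for s
    unfolding W_def by (rule hs_bound_conv[OF r bound[OF that] bound[OF that]]) simp
  have Wk: "cmod (W s k) \<le> algebra_const r * M * M" if "s \<in> {0..T}" for s
  proof -
    have "cmod (W s k) \<le> weight r k * cmod (W s k)"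
      using weight_ge_1[of r k] r by (intro mult_le_cancel_right1[THEN iffD2]) auto
    also have "\<dots> \<le> algebra_const r * M * M"
      using hs_boundD[OF W[OF that], of "{k}"] weight_pos[of r k] by simp
    finally show ?thesis .
  qed
  have meas': "set_borel_measurable lebesgue {0..T} (\<lambda>s. free_flow (c - s) (W s) k)" for c
    unfolding free_flow_def W_def
    by (intro set_borel_measurable_mult_continuous meas continuous_intros)
  have "set_integrable lebesgue {0..T} (\<lambda>s. free_flow (c - s) (W s) k)" for c
    by (rule set_integrable_bounded[OF _ meas', where K = "algebra_const r * M * M"])
      (use Wk in \<open>auto simp: free_flow_def norm_mult\<close>)
  then have int: "set_integrable lebesgue I (\<lambda>s. free_flow (c - s) (W s) k)"
    if "I \<in> sets lebesgue" "I \<subseteq> {0..T}" for c I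
    using that by (rule set_integrable_subset)
  show "set_integrable lebesgue {t..t'} (\<lambda>s. free_flow (t' - s) (conv (a s) (a s)) k)"
    using t int[of "{t..t'}"] by (simp add: W_def)
  have flow: "free_flow (t' - s) (W s) k = cis (- ((t' - t) * (of_int k)\<^sup>2)) * free_flow (t - s) (W s) k" for s
    by (simp add: free_flow_def cis_mult algebra_simps flip: mult.assoc)
  \<comment> \<open>A half-open interval makes the union disjoint.\<close>
  have "{0..t'} = {0..t} \<union> {t<..t'}" using t by auto
  then have "(LINT s:{0..t'}|lebesgue. free_flow (t' - s) (W s) k) =
      (LINT s:{0..t}|lebesgue. free_flow (t' - s) (W s) k) + (LINT s:{t..t'}|lebesgue. free_flow (t' - s) (W s) k)"
    unfolding set_integral_half_open[of t t', symmetric]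
    using t by (simp only:) (intro set_integral_Un int, auto)
  also have "(LINT s:{0..t}|lebesgue. free_flow (t' - s) (W s) k) =
      cis (- ((t' - t) * (of_int k)\<^sup>2)) * (LINT s:{0..t}|lebesgue. free_flow (t - s) (W s) k)"
    unfolding flow by simp
  finally have split: "(LINT s:{0..t'}|lebesgue. free_flow (t' - s) (W s) k) =
      cis (- ((t' - t) * (of_int k)\<^sup>2)) * (LINT s:{0..t}|lebesgue. free_flow (t - s) (W s) k)
      + (LINT s:{t..t'}|lebesgue. free_flow (t' - s) (W s) k)" .
  have flow0: "free_flow t' (a 0) k = cis (- ((t' - t) * (of_int k)\<^sup>2)) * free_flow t (a 0) k"
    by (simp add: free_flow_def cis_mult algebra_simps flip: mult.assoc)
  have at': "a t' k = free_flow t' (a 0) k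
      - \<i> * of_real \<mu> * (LINT s:{0..t'}|lebesgue. free_flow (t' - s) (W s) k)"
    unfolding W_def using t by (intro duhamel) auto
  have "free_flow (t' - t) (a t) k = cis (- ((t' - t) * (of_int k)\<^sup>2)) * a t k"
    by (simp add: free_flow_def)
  also have "a t k = free_flow t (a 0) k
      - \<i> * of_real \<mu> * (LINT s:{0..t}|lebesgue. free_flow (t - s) (W s) k)"
    unfolding W_def using t by (intro duhamel) auto
  finally show "a t' k = free_flow (t' - t) (a t) k
      - \<i> * of_real \<mu> * (LINT s:{t..t'}|lebesgue. free_flow (t' - s) (conv (a s) (a s)) k)"
    unfolding W_def[symmetric] at' split flow0 by (simp add: algebra_simps)
qed

text \<open>
  On one step, the solution departs from its free evolution by at most \<open>\<bar>\<mu>\<bar> C M\<^sup>2 \<tau>\<close> in \<open>H\<^sup>r\<close>, by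
  Duhamel's formula and the algebra property with constant \<open>C\<close>. The scheme makes only the error of
  inserting the free evolution into the quadratic term under the integral, which gives another
  factor \<open>\<tau>\<close>.
\<close>

lemma scheme_local_error:
  fixes a :: "real \<Rightarrow> int \<Rightarrow> complex"
  assumes r: "r > 1 / 2"
    and bound: "\<And>t. t \<in> {0..T} \<Longrightarrow> hs_bound r (a t) M"
    and meas: "\<And>k. set_borel_measurable lebesgue {0..T} (\<lambda>s. conv (a s) (a s) k)"
    and duhamel: "\<And>t k. t \<in> {0..T} \<Longrightarrow> a t k = free_flow t (a 0) k
      - \<i> * of_real \<mu> * (LINT s:{0..t}|lebesgue. free_flow (t - s) (conv (a s) (a s)) k)"
    and t: "0 \<le> t" "0 \<le> \<tau>" "t + \<tau> \<le> T"
  shows "hs_bound r (\<lambda>k. a (t + \<tau>) k - scheme_coeff \<mu> \<tau> (a t) k)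
    (2 * (\<bar>\<mu>\<bar> * algebra_const r)\<^sup>2 * M ^ 3 * \<tau>\<^sup>2)"
proof -
  let ?I = "{t..t + \<tau>}"
  let ?C = "algebra_const r"
  have C: "?C \<ge> 0" by (rule algebra_const_nonneg)
  have M: "M \<ge> 0" using hs_bound_nonneg[OF bound[of t]] t by auto
  note inter = duhamel_from_intermediate_time[OF r bound meas duhamel]
  have mu: "hs_bound r (\<lambda>k. - (\<i> * of_real \<mu> * b k)) (\<bar>\<mu>\<bar> * Y)" if "hs_bound r b Y" for b Y
    by (rule hs_bound_mult[OF that]) (auto simp: norm_mult)
  \<comment> \<open>The deviation from the free evolution, by Duhamel's formula on \<open>{t..s}\<close>.\<close>
  have lip: "hs_bound r (\<lambda>k. a s k - free_flow (s - t) (a t) k) (\<bar>\<mu>\<bar> * (\<tau> * (1 * ?C * M * M)))"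
    if s: "s \<in> ?I" for s
  proof -
    have "hs_bound r (\<lambda>k. LINT s':{t..s}|lebesgue. free_flow (s - s') (conv (a s') (a s')) k)
        (measure lebesgue {t..s} * (1 * ?C * M * M))"
    proof (rule hs_bound_set_integral)
      show "set_borel_measurable lebesgue {t..s} (\<lambda>s'. free_flow (s - s') (conv (a s') (a s')) k)" for k
        using inter(1)[of t s k] s t by (auto simp: set_integrable_def set_borel_measurable_def)
      show "hs_bound r (free_flow (s - s') (conv (a s') (a s'))) (1 * ?C * M * M)" if "s' \<in> {t..s}" for s'
        using that s t by (intro hs_bound_free_flow hs_bound_conv[OF r] bound) auto
    qed auto
    then have "hs_bound r (\<lambda>k. LINT s':{t..s}|lebesgue. free_flow (s - s') (conv (a s') (a s')) k)
        (\<tau> * (1 * ?C * M * M))"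
      by (rule hs_bound_mono) (use s C M in \<open>auto intro!: mult_right_mono\<close>)
    from mu[OF this] show ?thesis
      using inter(2)[of t s] s t by simp
  qed
  define Y where "Y = 1 * ?C * (M + M) * (\<bar>\<mu>\<bar> * (\<tau> * (1 * ?C * M * M)))"
  define g where "g s k = free_flow (t + \<tau> - s) (conv (a s) (a s)) k
     - free_flow (t + \<tau> - s) (conv (free_flow (s - t) (a t)) (free_flow (s - t) (a t))) k" for s k
  have at: "hs_bound r (a t) M" using bound t by auto
  have g: "hs_bound r (g s) Y" if s: "s \<in> ?I" for s
  proof -
    have "hs_bound r (\<lambda>k. conv (a s) (a s) k - conv (free_flow (s - t) (a t)) (free_flow (s - t) (a t)) k) Y"
      unfolding Y_def using s t
      by (intro hs_bound_conv_square_diff[OF r] lip bound hs_bound_free_flow at) auto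
    moreover have "g s = free_flow (t + \<tau> - s)
        (\<lambda>k. conv (a s) (a s) k - conv (free_flow (s - t) (a t)) (free_flow (s - t) (a t)) k)"
      unfolding g_def free_flow_def[of "t + \<tau> - s"] by (simp only: right_diff_distrib)
    ultimately show ?thesis by (simp only: hs_bound_free_flow)
  qed
  have int1: "set_integrable lebesgue ?I (\<lambda>s. free_flow (t + \<tau> - s) (conv (a s) (a s)) k)" for k
    using inter(1)[of t "t + \<tau>" k] t by simp
  have int2: "set_integrable lebesgue ?I
      (\<lambda>s. free_flow (t + \<tau> - s) (conv (free_flow (s - t) (a t)) (free_flow (s - t) (a t))) k)" for k
    by (rule integral_free_flow_conv(1)[OF r at t(2)])
  have "hs_bound r (\<lambda>k. LINT s:?I|lebesgue. g s k) (measure lebesgue ?I * Y)"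
  proof (rule hs_bound_set_integral[OF _ _ g])
    show "set_borel_measurable lebesgue ?I (\<lambda>s. g s k)" for k
      using set_integral_diff(1)[OF int1 int2, of k k]
      by (auto simp: set_integrable_def set_borel_measurable_def g_def)
  qed auto
  from mu[OF this] have "hs_bound r (\<lambda>k. - (\<i> * of_real \<mu> * (LINT s:?I|lebesgue. g s k))) (\<bar>\<mu>\<bar> * (\<tau> * Y))"
    using t by simp
  moreover have "a (t + \<tau>) k - scheme_coeff \<mu> \<tau> (a t) k = - (\<i> * of_real \<mu> * (LINT s:?I|lebesgue. g s k))" for k
  proof -
    have exact: "a (t + \<tau>) k = free_flow \<tau> (a t) k
        - \<i> * of_real \<mu> * (LINT s:?I|lebesgue. free_flow (t + \<tau> - s) (conv (a s) (a s)) k)"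
      using inter(2)[of t "t + \<tau>" k] t by simp
    show ?thesis
      unfolding exact scheme_coeff_def g_def set_integral_diff(2)[OF int1 int2]
        integral_free_flow_conv(2)[OF r at t(2)]
      by (simp add: algebra_simps)
  qed
  moreover have "\<bar>\<mu>\<bar> * (\<tau> * Y) = 2 * (\<bar>\<mu>\<bar> * ?C)\<^sup>2 * M ^ 3 * \<tau>\<^sup>2"
    by (simp add: Y_def power2_eq_square power3_eq_cube algebra_simps)
  ultimately show ?thesis by simp
qed

lemma scheme_coeff_stable:
  assumes r: "r > 1 / 2" and \<tau>: "\<tau> \<ge> 0" and a: "hs_bound r a X" and b: "hs_bound r b Y"
    and d: "hs_bound r (\<lambda>k. a k - b k) D"
  shows "hs_bound r (\<lambda>k. scheme_coeff \<mu> \<tau> a k - scheme_coeff \<mu> \<tau> b k)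
    (D + \<bar>\<mu>\<bar> * (\<tau> * algebra_const r * (X + Y) * D))"
proof -
  let ?m = "\<lambda>j l. phase_integral \<tau> (j * l)"
  have "hs_bound r (\<lambda>k. twisted_conv ?m a a k - twisted_conv ?m b b k) (\<tau> * algebra_const r * (X + Y) * D)"
    by (rule hs_bound_conv_square_diff[OF r a b d norm_phase_integral_le[OF \<tau>]])
  from hs_bound_free_flow[OF this, of \<tau>]
  have "hs_bound r (\<lambda>k. \<i> * of_real \<mu> * free_flow \<tau> (\<lambda>k. twisted_conv ?m a a k - twisted_conv ?m b b k) k)
      (\<bar>\<mu>\<bar> * (\<tau> * algebra_const r * (X + Y) * D))"
    by (rule hs_bound_mult) (auto simp: norm_mult)
  from hs_bound_diff[OF hs_bound_free_flow[OF d, of \<tau>] this] show ?thesis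
    by (simp add: scheme_coeff_def free_flow_def algebra_simps)
qed

lemma hs_bound_scheme_coeff:
  assumes r: "r > 1 / 2" and \<tau>: "\<tau> \<ge> 0" and a: "hs_bound r a X"
  shows "hs_bound r (scheme_coeff \<mu> \<tau> a) (X + \<bar>\<mu>\<bar> * (\<tau> * algebra_const r * X * X))"
proof -
  let ?m = "\<lambda>j l. phase_integral \<tau> (j * l)"
  have "hs_bound r (twisted_conv ?m a a) (\<tau> * algebra_const r * X * X)"
    by (rule hs_bound_conv[OF r a a norm_phase_integral_le[OF \<tau>]])
  from hs_bound_free_flow[OF this, of \<tau>]
  have "hs_bound r (\<lambda>k. \<i> * of_real \<mu> * free_flow \<tau> (twisted_conv ?m a a) k)
      (\<bar>\<mu>\<bar> * (\<tau> * algebra_const r * X * X))"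
    by (rule hs_bound_mult) (auto simp: norm_mult)
  from hs_bound_diff[OF hs_bound_free_flow[OF a, of \<tau>] this] show ?thesis
    by (simp add: scheme_coeff_def[abs_def])
qed

lemma scheme_sobolev:
  assumes r: "r > 1 / 2" and \<tau>: "\<tau> \<ge> 0" and v: "v \<in> sobolev r"
  shows "scheme \<mu> \<tau> v n \<in> sobolev r"
    and "fourier_coeff (scheme \<mu> \<tau> v (Suc n)) = scheme_coeff \<mu> \<tau> (fourier_coeff (scheme \<mu> \<tau> v n))"
proof -
  have step: "scheme_step \<mu> \<tau> w \<in> sobolev r \<and> fourier_coeff (scheme_step \<mu> \<tau> w) = scheme_coeff \<mu> \<tau> (fourier_coeff w)"
    if "w \<in> sobolev r" for w
  proof -
    note w = sobolev_hs_bound[OF that]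
    note s = hs_bound_scheme_coeff[OF r \<tau> w, of \<mu>]
    show ?thesis
      unfolding scheme_step_eq_trig_series[OF r w \<tau>]
      using trig_series_sobolev[OF r s] fourier_coeff_trig_series[OF hs_bound_abs_summable[OF r s]] by auto
  qed
  show *: "scheme \<mu> \<tau> v n \<in> sobolev r" for n
    by (induction n) (use v step in auto)
  show "fourier_coeff (scheme \<mu> \<tau> v (Suc n)) = scheme_coeff \<mu> \<tau> (fourier_coeff (scheme \<mu> \<tau> v n))"
    using step[OF *[of n]] by simp
qed

text \<open>
  The discrete Gronwall argument. The stability estimate needs a bound on the iterate, which the
  error bound itself provides: by the smallness of \<open>\<tau>\<close> the error is at most 1 at each step, so the
  iterate stays in the ball of radius \<open>M + 1\<close>.
\<close>

lemma scheme_global_error: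
  fixes a :: "real \<Rightarrow> int \<Rightarrow> complex" and b :: "nat \<Rightarrow> int \<Rightarrow> complex"
  assumes r: "r > 1 / 2"
    and bound: "\<And>t. t \<in> {0..T} \<Longrightarrow> hs_bound r (a t) M"
    and local_error: "\<And>t. 0 \<le> t \<Longrightarrow> t + \<tau> \<le> T \<Longrightarrow>
      hs_bound r (\<lambda>k. a (t + \<tau>) k - scheme_coeff \<mu> \<tau> (a t) k) (L * \<tau>\<^sup>2)"
    and b0: "b 0 = a 0" and b_Suc: "\<And>n. b (Suc n) = scheme_coeff \<mu> \<tau> (b n)"
    and K: "K = \<bar>\<mu>\<bar> * algebra_const r * (2 * M + 1)" and L: "L \<ge> 0"
    and \<tau>: "0 < \<tau>" "T * L * exp (K * T) * \<tau> \<le> 1" and M: "M \<ge> 0"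
    and n: "real n * \<tau> \<le> T"
  shows "hs_bound r (\<lambda>k. a (real n * \<tau>) k - b n k) (real n * L * \<tau>\<^sup>2 * exp (K * (real n * \<tau>)))"
  using n
proof (induction n)
  case 0
  show ?case by (simp add: b0 hs_bound_def L2_set_def)
next
  case (Suc n)
  have K0: "K \<ge> 0" using M by (simp add: K algebra_const_nonneg)
  define t where "t = real n * \<tau>"
  have t: "0 \<le> t" "t + \<tau> \<le> T" "real (Suc n) * \<tau> = t + \<tau>"
    using Suc.prems \<tau> by (auto simp: t_def algebra_simps)
  define E where "E = real n * L * \<tau>\<^sup>2 * exp (K * t)"
  have E: "hs_bound r (\<lambda>k. a t k - b n k) E"
    using Suc.IH t \<tau> by (simp add: t_def E_def)
  have at: "hs_bound r (a t) M" using bound t \<tau> by auto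
  have "E = (real n * \<tau>) * L * exp (K * t) * \<tau>" by (simp add: E_def power2_eq_square)
  also have "\<dots> \<le> T * L * exp (K * T) * \<tau>"
    using t \<tau> L K0 by (intro mult_right_mono mult_mono) (auto simp: t_def[symmetric] intro!: mult_left_mono)
  also have "\<dots> \<le> 1" by fact
  finally have E1: "E \<le> 1" .
  have "hs_bound r (b n) (M + E)"
    using hs_bound_diff[OF at E] by simp
  then have bn: "hs_bound r (b n) (M + 1)" by (rule hs_bound_mono) (use E1 in simp)
  have "hs_bound r (\<lambda>k. (a (t + \<tau>) k - scheme_coeff \<mu> \<tau> (a t) k)
      + (scheme_coeff \<mu> \<tau> (a t) k - scheme_coeff \<mu> \<tau> (b n) k))
      (L * \<tau>\<^sup>2 + (E + \<bar>\<mu>\<bar> * (\<tau> * algebra_const r * (M + (M + 1)) * E)))"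
    by (rule hs_bound_add[OF local_error scheme_coeff_stable[OF r _ at bn E]]) (use t \<tau> in auto)
  also have "E + \<bar>\<mu>\<bar> * (\<tau> * algebra_const r * (M + (M + 1)) * E) = (1 + K * \<tau>) * E"
    by (simp add: K algebra_simps)
  finally have "hs_bound r (\<lambda>k. a (t + \<tau>) k - b (Suc n) k) (L * \<tau>\<^sup>2 + (1 + K * \<tau>) * E)"
    by (simp add: b_Suc)
  moreover have "L * \<tau>\<^sup>2 + (1 + K * \<tau>) * E \<le> real (Suc n) * L * \<tau>\<^sup>2 * exp (K * (t + \<tau>))"
  proof -
    have "(1 + K * \<tau>) * E \<le> exp (K * \<tau>) * E"
      using L exp_ge_add_one_self[of "K * \<tau>"] by (intro mult_right_mono) (auto simp: E_def)
    also have "\<dots> = real n * L * \<tau>\<^sup>2 * exp (K * (t + \<tau>))"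
      by (simp add: E_def distrib_left exp_add)
    finally have "(1 + K * \<tau>) * E \<le> real n * L * \<tau>\<^sup>2 * exp (K * (t + \<tau>))" .
    moreover have "L * \<tau>\<^sup>2 * 1 \<le> L * \<tau>\<^sup>2 * exp (K * (t + \<tau>))"
      using L K0 t \<tau> by (intro mult_left_mono) auto
    ultimately show ?thesis by (simp add: algebra_simps)
  qed
  ultimately show ?case unfolding t(3) by (rule hs_bound_mono)
qed

theorem corollary3p4:
  fixes \<mu> T r :: real
  assumes "T > 0" and "r > 1 / 2"
  shows "\<exists>c :: real \<Rightarrow> real. \<forall>u :: real \<Rightarrow> real \<Rightarrow> complex.
    mild_solution \<mu> T u \<longrightarrow>
    (\<forall>t\<in>{0..T}. u t \<in> sobolev r) \<longrightarrow>
    bdd_above ((\<lambda>t. sobolev_norm r (u t)) ` {0..T}) \<longrightarrow>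
    (\<exists>\<tau>\<^sub>0>0. \<forall>\<tau> n. 0 < \<tau> \<longrightarrow> \<tau> \<le> \<tau>\<^sub>0 \<longrightarrow> real n * \<tau> \<le> T \<longrightarrow>
      (\<lambda>x. u (real n * \<tau>) x - scheme \<mu> \<tau> (u 0) n x) \<in> sobolev r \<and>
      sobolev_norm r (\<lambda>x. u (real n * \<tau>) x - scheme \<mu> \<tau> (u 0) n x)
        \<le> c (SUP t\<in>{0..T}. sobolev_norm r (u t)) * \<tau>)"
proof -
  define K where "K M = \<bar>\<mu>\<bar> * algebra_const r * (2 * M + 1)" for M
  define L where "L M = 2 * (\<bar>\<mu>\<bar> * algebra_const r)\<^sup>2 * M ^ 3" for M
  define c where "c M = T * L M * exp (K M * T)" for M
  show ?thesis
  proof (intro exI[of _ c] allI impI)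
    fix u :: "real \<Rightarrow> real \<Rightarrow> complex"
    assume mild: "mild_solution \<mu> T u" and sob: "\<forall>t\<in>{0..T}. u t \<in> sobolev r"
      and bdd: "bdd_above ((\<lambda>t. sobolev_norm r (u t)) ` {0..T})"
    define M where "M = (SUP t\<in>{0..T}. sobolev_norm r (u t))"
    define a where "a t = fourier_coeff (u t)" for t
    have bound: "hs_bound r (a t) M" if "t \<in> {0..T}" for t
      unfolding a_def M_def
      using sobolev_hs_bound[of "u t" r] sob that cSUP_upper[OF that bdd] hs_bound_mono by blast
    have M: "M \<ge> 0" using bound[of 0] assms by (auto intro: hs_bound_nonneg)
    have L: "L M \<ge> 0" using M by (simp add: L_def)
    have c0: "c M \<ge> 0" using L assms by (simp add: c_def)
    have T0: "T \<ge> 0" using assms by simp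
    have sob': "u t \<in> sobolev r" if "t \<in> {0..T}" for t using sob that by blast
    note coeff = mild_solution_coeff[OF assms(2) T0 mild sob' bound[unfolded a_def], folded a_def]
    show "\<exists>\<tau>\<^sub>0>0. \<forall>\<tau> n. 0 < \<tau> \<longrightarrow> \<tau> \<le> \<tau>\<^sub>0 \<longrightarrow> real n * \<tau> \<le> T \<longrightarrow>
      (\<lambda>x. u (real n * \<tau>) x - scheme \<mu> \<tau> (u 0) n x) \<in> sobolev r \<and>
      sobolev_norm r (\<lambda>x. u (real n * \<tau>) x - scheme \<mu> \<tau> (u 0) n x)
        \<le> c (SUP t\<in>{0..T}. sobolev_norm r (u t)) * \<tau>"
    \<comment> \<open>This threshold makes the final error bound \<open>c M * \<tau>\<close> at most 1, as the Gronwall argument requires;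
      the summand 1 excludes division by zero.\<close>
    proof (intro exI[of _ "1 / (c M + 1)"] conjI allI impI)
      show "1 / (c M + 1) > 0" using c0 by simp
    next
      fix \<tau> :: real and n :: nat
      assume \<tau>: "0 < \<tau>" "\<tau> \<le> 1 / (c M + 1)" and n: "real n * \<tau> \<le> T"
      have \<tau>0: "\<tau> \<ge> 0" using \<tau> by simp
      have u0: "u 0 \<in> sobolev r" using sob assms by auto
      have un: "u (real n * \<tau>) \<in> sobolev r" using sob n \<tau> by auto
      note sch = scheme_sobolev[OF assms(2) \<tau>0 u0]
      show "(\<lambda>x. u (real n * \<tau>) x - scheme \<mu> \<tau> (u 0) n x) \<in> sobolev r"
        by (rule sobolev_diff(1)[OF un sch(1)])
      have "c M * \<tau> \<le> 1"
        using \<tau> c0 by (simp add: field_simps)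
      then have small: "T * L M * exp (K M * T) * \<tau> \<le> 1" by (simp add: c_def)
      define b where "b n = fourier_coeff (scheme \<mu> \<tau> (u 0) n)" for n
      have le: "hs_bound r (\<lambda>k. a (t + \<tau>) k - scheme_coeff \<mu> \<tau> (a t) k) (L M * \<tau>\<^sup>2)"
        if "0 \<le> t" "t + \<tau> \<le> T" for t
        unfolding L_def by (rule scheme_local_error[OF assms(2) bound coeff that(1) \<tau>0 that(2)])
      have "hs_bound r (\<lambda>k. a (real n * \<tau>) k - b n k) (real n * L M * \<tau>\<^sup>2 * exp (K M * (real n * \<tau>)))"
      proof (rule scheme_global_error[where T = T and M = M and \<mu> = \<mu>])
        show "b (Suc n) = scheme_coeff \<mu> \<tau> (b n)" for n
          unfolding b_def by (rule sch(2))
      qed (use assms(2) bound le L \<tau>(1) small M n in \<open>auto simp: a_def b_def K_def\<close>)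
      also have "(\<lambda>k. a (real n * \<tau>) k - b n k) =
          fourier_coeff (\<lambda>x. u (real n * \<tau>) x - scheme \<mu> \<tau> (u 0) n x)"
        unfolding a_def b_def by (rule sobolev_diff(2)[OF un sch(1), symmetric])
      finally have "sobolev_norm r (\<lambda>x. u (real n * \<tau>) x - scheme \<mu> \<tau> (u 0) n x)
          \<le> real n * L M * \<tau>\<^sup>2 * exp (K M * (real n * \<tau>))"
        by (rule sobolev_norm_le)
      also have "\<dots> = (real n * \<tau>) * L M * exp (K M * (real n * \<tau>)) * \<tau>"
        by (simp add: power2_eq_square)
      also have "\<dots> \<le> c M * \<tau>"
        unfolding c_def using n \<tau> L M T0 algebra_const_nonneg[of r]
        by (intro mult_right_mono mult_mono) (auto simp: K_def intro!: mult_left_mono)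
      finally show "sobolev_norm r (\<lambda>x. u (real n * \<tau>) x - scheme \<mu> \<tau> (u 0) n x)
          \<le> c (SUP t\<in>{0..T}. sobolev_norm r (u t)) * \<tau>"
        by (simp add: M_def)
    qed
  qed
qed

end
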